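(* Let $A$ be a semisimple complex Banach algebra with identity, and suppose that $\mathrm{Soc}\,A$ is a minimal two-sided ideal of $A$. Then for every linear functional $f$ on $\mathrm{Soc}\,A$ the following are equivalent: (a) $f=\alpha\,\mathrm{Tr}$ for some $\alpha\in\mathbb{C}$. (b) $f(a)=0$ for each nilpotent $a\in\mathrm{Soc}\,A$. (c) For each $a\in\mathrm{Soc}\,A$, $f(a)=0$ whenever $a^2=0$. (d) There exists a real number $c>0$ such that $|f(a)|\le c\cdot\mathrm{rank}(a)\cdot\rho(a)$ for all $a\in\mathrm{Soc}\,A$.
   Context: $A$ is a semisimple complex Banach algebra with identity $\mathbf 1$. For $x\in A$, $\sigma(x)$ is the spectrum, $\sigma'(x)=\sigma(x)\setminus\{0\}$, and $\rho(x)$ is the spectral radius; $\#K$ denotes the number of elements of a set $K$. The rank of $a\in A$ is $\mathrm{rank}(a)=\sup_{x\in A}\#\sigma'(xa)\in\{0,1,2,\dots\}\cup\{\infty\}$. The socle $\mathrm{Soc}\,A$ is the two-sided ideal of all finite-rank elements of $A$ (it coincides with the usual socle, the sum of all minimal left ideals, and is $\{0\}$ if there are none). For $a\in \mathrm{Soc}\,A$ let $E(a)=\{x\in A:\#\sigma'(xa)=\mathrm{rank}(a)\}$, which is a dense open subset of $A$. For $a\in\mathrm{Soc}\,A$ and $\lambda\in\sigma(a)$, let $B(\lambda,r)$ be an open disk whose closure contains no point of $\sigma(a)$ other than $\lambda$; there is an open ball $U\subseteq A$ centered at $\mathbf 1$ such that $\#[\sigma(xa)\cap B(\lambda,r)]$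 is constant for $x\in E(a)\cap U$, and this constant is the multiplicity $m(\lambda,a)$. The trace is $\mathrm{Tr}(a)=\sum_{\lambda\in\sigma(a)}\lambda\, m(\lambda,a)$ for $a\in\mathrm{Soc}\,A$; it is a linear functional on $\mathrm{Soc}\,A$. Linear functionals are complex-linear and not assumed continuous. A two-sided ideal $J$ of $A$ is called minimal here if the only two-sided ideals of $A$ contained in $J$ are $\{0\}$ and $J$ (so $J=\{0\}$ is allowed). *)

theory Defs
  imports "HOL-Analysis.Analysis" "HOL-Library.Extended_Nat"
begin

section \<open>Complex Banach algebras with identity\<close>

text \<open>
  The distribution only has real normed algebras. Complex scalar multiplication is added on top of
  them and is required to extend the real one. The class \<^class>\<open>real_algebra_1\<close> supplies
  an identity with \<open>0 \<noteq> 1\<close>; the normalisation \<open>norm 1 = 1\<close> is not imposed.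
\<close>

class scaleC =
  fixes scaleC :: "complex \<Rightarrow> 'a \<Rightarrow> 'a"  (infixr \<open>*\<^sub>C\<close> 75)

class complex_banach_algebra_1 = real_normed_algebra + real_algebra_1 + banach + scaleC +
  assumes scaleC_add_right: "c *\<^sub>C (x + y) = c *\<^sub>C x + c *\<^sub>C y"
    and scaleC_add_left: "(c + d) *\<^sub>C x = c *\<^sub>C x + d *\<^sub>C x"
    and scaleC_scaleC: "c *\<^sub>C d *\<^sub>C x = (c * d) *\<^sub>C x"
    and scaleC_one: "1 *\<^sub>C x = x"
    and scaleC_of_real: "complex_of_real r *\<^sub>C x = r *\<^sub>R x"
    and mult_scaleC_left: "(c *\<^sub>C x) * y = c *\<^sub>C (x * y)"
    and mult_scaleC_right: "x * (c *\<^sub>C y) = c *\<^sub>C (x * y)"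
    and norm_scaleC: "norm (c *\<^sub>C x) = cmod c * norm x"

instantiation complex :: complex_banach_algebra_1
begin

definition scaleC_complex :: "complex \<Rightarrow> complex \<Rightarrow> complex" where
  "scaleC_complex c x = c * x"

instance
  by standard (auto simp: scaleC_complex_def algebra_simps scaleR_conv_of_real norm_mult)

end

section \<open>Ideals and semisimplicity\<close>

text \<open>
  Since the algebra has an identity, closure under complex scalars follows from closure under
  multiplication by \<open>c *\<^sub>C 1\<close>.
\<close>

definition left_ideal :: "'a::ring_1 set \<Rightarrow> bool" where
  "left_ideal I \<longleftrightarrow>
     0 \<in> I \<and> (\<forall>x\<in>I. \<forall>y\<in>I. x + y \<in> I) \<and> (\<forall>a. \<forall>x\<in>I. a * x \<in> I)"

definition two_sided_ideal :: "'a::ring_1 set \<Rightarrow> bool" where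
  "two_sided_ideal I \<longleftrightarrow> left_ideal I \<and> (\<forall>a. \<forall>x\<in>I. x * a \<in> I)"

definition maximal_left_ideal :: "'a::ring_1 set \<Rightarrow> bool" where
  "maximal_left_ideal I \<longleftrightarrow>
     left_ideal I \<and> I \<noteq> UNIV \<and> (\<forall>J. left_ideal J \<and> I \<subseteq> J \<longrightarrow> J = I \<or> J = UNIV)"

definition jacobson_radical :: "'a::ring_1 set" where
  "jacobson_radical = \<Inter> {I. maximal_left_ideal I}"

definition semisimple :: "'a::ring_1 itself \<Rightarrow> bool" where
  "semisimple TYPE('a) \<longleftrightarrow> (jacobson_radical :: 'a set) = {0}"

text \<open>The zero ideal counts as minimal.\<close>

definition minimal_two_sided_ideal :: "'a::ring_1 set \<Rightarrow> bool" where
  "minimal_two_sided_ideal J \<longleftrightarrow>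
     two_sided_ideal J \<and> (\<forall>I. two_sided_ideal I \<and> I \<subseteq> J \<longrightarrow> I = {0} \<or> I = J)"

definition nilpotent :: "'a::ring_1 \<Rightarrow> bool" where
  "nilpotent a \<longleftrightarrow> (\<exists>n::nat. a ^ n = 0)"

section \<open>Spectrum, rank and socle\<close>

definition spectrum :: "'a::complex_banach_algebra_1 \<Rightarrow> complex set" where
  "spectrum x =
     {z. \<not> (\<exists>y. (z *\<^sub>C 1 - x) * y = 1 \<and> y * (z *\<^sub>C 1 - x) = 1)}"

definition nonzero_spectrum :: "'a::complex_banach_algebra_1 \<Rightarrow> complex set" where
  "nonzero_spectrum x = spectrum x - {0}"

definition spectral_radius :: "'a::complex_banach_algebra_1 \<Rightarrow> real" where
  "spectral_radius x = (SUP z\<in>spectrum x. cmod z)"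

definition ecard :: "'b set \<Rightarrow> enat" where
  "ecard K = (if finite K then enat (card K) else \<infinity>)"

definition elem_rank :: "'a::complex_banach_algebra_1 \<Rightarrow> enat" where
  "elem_rank a = (SUP x. ecard (nonzero_spectrum (x * a)))"

definition Soc :: "'a::complex_banach_algebra_1 set" where
  "Soc = {a. elem_rank a \<noteq> \<infinity>}"

section \<open>Multiplicity and trace\<close>

definition rank_attaining :: "'a::complex_banach_algebra_1 \<Rightarrow> 'a set" where
  "rank_attaining a = {x. ecard (nonzero_spectrum (x * a)) = elem_rank a}"

text \<open>
  The number obtained does not depend on the admissible radius \<open>r\<close>, so it is described as
  the number that works for all of them. It is meaningful for \<open>a \<in> Soc\<close> and
  \<open>z \<in> spectrum a\<close>.
\<close>

definition spectral_multiplicity :: "complex \<Rightarrow> 'a::complex_banach_algebra_1 \<Rightarrow> nat" where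
  "spectral_multiplicity z a =
     (THE n. \<forall>r>0. closure (ball z r) \<inter> spectrum a \<subseteq> {z} \<longrightarrow>
        (\<exists>\<epsilon>>0. \<forall>x \<in> rank_attaining a \<inter> ball 1 \<epsilon>.
           ecard (spectrum (x * a) \<inter> ball z r) = enat n))"

definition Tr :: "'a::complex_banach_algebra_1 \<Rightarrow> complex" where
  "Tr a = (\<Sum>z\<in>spectrum a. z * of_nat (spectral_multiplicity z a))"

section \<open>Linear functionals\<close>

text \<open>
  A functional on a subspace is a total function whose values outside the subspace are irrelevant.
\<close>

definition linear_functional_on ::
  "'a::complex_banach_algebra_1 set \<Rightarrow> ('a \<Rightarrow> complex) \<Rightarrow> bool" where
  "linear_functional_on S f \<longleftrightarrow>
     (\<forall>a\<in>S. \<forall>b\<in>S. f (a + b) = f a + f b) \<and> (\<forall>c. \<forall>a\<in>S. f (c *\<^sub>C a) = c * f a)"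

end

theory Submission
  imports Defs "Jordan_Normal_Form.Schur_Decomposition"
begin

text \<open>
  The operative implications are from (c) to (a) and to (d). Suppose that the socle is nonzero.

  Semisimplicity provides a maximal left ideal \<open>M\<close> not containing the socle, and minimality of the
  socle makes its action on the irreducible module \<open>A / M\<close> faithful. The commutant of \<open>A / M\<close> is
  the complex field (Gelfand--Mazur), so by density a socle element whose operator on \<open>A / M\<close> had
  infinite rank would have infinite spectral rank. Cutting down a nonzero socle element by density
  gives an idempotent \<open>e\<close> with \<open>e * z * e = \<phi> z *\<^sub>C e\<close> for a linear functional \<open>\<phi>\<close>.

  Every socle element is \<open>a = (\<Sum>i<n. x i * e * y i)\<close>, and with \<open>n\<close> minimal the families
  \<open>x i * e\<close> and \<open>e * y i\<close> are independent. The nonzero spectrum of \<open>u * a\<close> consists of the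
  nonzero eigenvalues of the \<open>n \<times> n\<close> matrix with entries \<open>\<phi> (y i * u * x j)\<close>, and \<open>u\<close>
  can be chosen to make this matrix arbitrary. Hence \<open>a\<close> has rank \<open>n\<close>, spectral multiplicities are algebraic
  multiplicities by continuity of roots, \<open>Tr a = (\<Sum>i<n. \<phi> (y i * x i))\<close>, and the bound in (d) for
  the trace follows. A functional killing square-zero elements satisfies
  \<open>f (x * e * y) = f e * \<phi> (y * x)\<close>, whence \<open>f = f e \<cdot> Tr\<close>.
\<close>

subsection \<open>Characteristic polynomials and continuity of roots\<close>

text \<open>\<open>Tr\<close> is built from numbers of spectral points of nearby elements
  \<open>u * a\<close>, so neither its linearity nor a formula for it is visible in the definition.
  The matrix of the overview repairs this. With a = X e Y for a row X of the \<open>x i\<close> and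
  a column Y of the \<open>y i\<close>, it is the matrix of e Y X e, and products in the two orders
  have the same spectrum off zero. At zero they may differ, which is why zero is treated separately
  throughout. If \<open>u\<close> attains the rank n, the eigenvalues for \<open>u * a\<close> are
  nonzero and all simple, so counting points is counting roots with multiplicity; letting
  \<open>u\<close> tend to 1 turns these counts into algebraic multiplicities for \<open>a\<close>.
  Beyond faithfulness, minimality of the socle is used twice more: it makes \<open>e\<close>
  generate the socle, and it makes the form \<phi>(y x) nondegenerate, which is what allows the
  matrix to be prescribed through \<open>u\<close>.\<close>

abbreviation charpoly :: "nat \<Rightarrow> (nat \<Rightarrow> nat \<Rightarrow> complex) \<Rightarrow> complex poly" where
  "charpoly n G \<equiv> char_poly (mat n n (\<lambda>(i, j). G i j))"

lemma index_mult_mat_sum: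
  assumes "A \<in> carrier_mat n n" "B \<in> carrier_mat n n" "i < n" "j < n"
  shows "(A * B) $$ (i, j) = (\<Sum>k<n. A $$ (i, k) * B $$ (k, j))"
  using assms by (auto simp: scalar_prod_def atLeast0LessThan intro!: sum.cong)

lemma charpoly_factorization:
  obtains es where "charpoly n G = (\<Prod>e\<leftarrow>es. [:- e, 1:])" "length es = n"
  using char_poly_factorized[of "mat n n (\<lambda>(i, j). G i j)" n] by auto

lemma charpoly_root_iff:
  "poly (charpoly n G) z = 0 \<longleftrightarrow>
     (\<exists>c. (\<exists>i<n. c i \<noteq> 0) \<and> (\<forall>i<n. (\<Sum>j<n. G i j * c j) = z * c i))"
proof -
  let ?A = "mat n n (\<lambda>(i, j). G i j)"
  have eq: "?A *\<^sub>v v = z \<cdot>\<^sub>v v \<longleftrightarrow> (\<forall>i<n. (\<Sum>j<n. G i j * (vec_index v j)) = z * (vec_index v i))"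
    if "v \<in> carrier_vec n" for v
    using that by (auto simp: vec_eq_iff scalar_prod_def atLeast0LessThan 
      )
  have "poly (charpoly n G) z = 0 \<longleftrightarrow> eigenvalue ?A z"
    using eigenvalue_root_char_poly[of ?A n z] by auto
  also have "\<dots> \<longleftrightarrow> (\<exists>v. v \<in> carrier_vec n \<and> v \<noteq> 0\<^sub>v n \<and>
      (\<forall>i<n. (\<Sum>j<n. G i j * (vec_index v j)) = z * (vec_index v i)))"
    unfolding eigenvalue_def eigenvector_def using eq by auto
  also have "\<dots> \<longleftrightarrow> (\<exists>c. (\<exists>i<n. c i \<noteq> 0) \<and> (\<forall>i<n. (\<Sum>j<n. G i j * c j) = z * c i))"
    (is "?L \<longleftrightarrow> ?R")
  proof
    assume ?L
    then obtain v where v: "v \<in> carrier_vec n" "v \<noteq> 0\<^sub>v n"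
      "\<forall>i<n. (\<Sum>j<n. G i j * (vec_index v j)) = z * (vec_index v i)" by blast
    then have "\<exists>i<n. vec_index v i \<noteq> 0" by (auto simp: vec_eq_iff)
    then show ?R using v(3) by (intro exI[of _ "\<lambda>i. vec_index v i"]) auto
  next
    assume ?R
    then obtain c where c: "\<exists>i<n. c i \<noteq> 0" "\<forall>i<n. (\<Sum>j<n. G i j * c j) = z * c i" by blast
    have "vec n c \<noteq> 0\<^sub>v n" using c(1) by (auto simp: vec_eq_iff)
    moreover have "\<forall>i<n. (\<Sum>j<n. G i j * (vec_index (vec n c) j)) = z * (vec_index (vec n c) i)"
      using c(2) by auto
    ultimately show ?L by (intro exI[of _ "vec n c"]) auto
  qed
  finally show ?thesis .
qed

text \<open>\<open>H\<close> is the inverse of z - G in coordinates. Both one-sided identities are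
  recorded because membership in \<open>spectrum\<close> is decided by two-sided inverses.\<close>

lemma charpoly_nonroot_inverse:
  assumes "poly (charpoly n G) z \<noteq> 0"
  obtains H where
    "\<And>i k. i < n \<Longrightarrow> k < n \<Longrightarrow> z * H i k - (\<Sum>j<n. G i j * H j k) = (if i = k then 1 else 0)"
    "\<And>i k. i < n \<Longrightarrow> k < n \<Longrightarrow> z * H i k - (\<Sum>j<n. H i j * G j k) = (if i = k then 1 else 0)"
proof -
  let ?A = "mat n n (\<lambda>(i, j). G i j)"
  let ?B = "- (char_matrix ?A z)"
  have B: "?B \<in> carrier_mat n n" by simp
  have Bij: "?B $$ (i, j) = (if i = j then z else 0) - G i j" if "i < n" "j < n" for i j
    using that by (auto simp: char_matrix_def)
  have "det ?B \<noteq> 0"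
    using assms char_poly_matrix[of ?A n z] by simp
  from det_non_zero_imp_unit[OF B this, of "()"] obtain C where
    C: "C \<in> carrier_mat n n" "?B * C = 1\<^sub>m n" "C * ?B = 1\<^sub>m n"
    by (auto simp: Units_def ring_mat_def)
  have 1: "z * C $$ (i, k) - (\<Sum>j<n. G i j * C $$ (j, k)) = (if i = k then 1 else 0)"
    if ik: "i < n" "k < n" for i k
  proof -
    have "(if i = k then 1 else 0) = (?B * C) $$ (i, k)" using C(2) ik by simp
    also have "\<dots> = (\<Sum>j<n. ?B $$ (i, j) * C $$ (j, k))"
      by (rule index_mult_mat_sum) (use ik C(1) B in auto)
    also have "\<dots> = (\<Sum>j<n. (if i = j then z * C $$ (i, k) else 0) - G i j * C $$ (j, k))"
      by (intro sum.cong) (use ik in \<open>auto simp: Bij left_diff_distrib right_diff_distrib mult.commute simp del: index_uminus_mat\<close>)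
    finally show ?thesis using ik by (simp add: sum_subtractf)
  qed
  have 2: "z * C $$ (i, k) - (\<Sum>j<n. C $$ (i, j) * G j k) = (if i = k then 1 else 0)"
    if ik: "i < n" "k < n" for i k
  proof -
    have "(if i = k then 1 else 0) = (C * ?B) $$ (i, k)" using C(3) ik by simp
    also have "\<dots> = (\<Sum>j<n. C $$ (i, j) * ?B $$ (j, k))"
      by (rule index_mult_mat_sum) (use ik C(1) B in auto)
    also have "\<dots> = (\<Sum>j<n. (if k = j then z * C $$ (i, k) else 0) - C $$ (i, j) * G j k)"
      by (intro sum.cong) (use ik in \<open>auto simp: Bij left_diff_distrib right_diff_distrib mult.commute simp del: index_uminus_mat\<close>)
    finally show ?thesis using ik by (simp add: sum_subtractf)
  qed
  show thesis using 1 2 by (intro that[of "\<lambda>i j. C $$ (i, j)"])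
qed

text \<open>By the Leibniz formula the value is a fixed polynomial in the entries, so entrywise
  convergence suffices.\<close>

lemma tendsto_poly_charpoly:
  assumes "\<And>i j. i < n \<Longrightarrow> j < n \<Longrightarrow> ((\<lambda>k. G k i j) \<longlongrightarrow> H i j) F"
  shows "((\<lambda>k. poly (charpoly n (G k)) z) \<longlongrightarrow> poly (charpoly n H) z) F"
proof -
  have eq: "poly (charpoly n K) z = (\<Sum>p | p permutes {0..<n}.
      signof p * (\<Prod>i = 0..<n. (if i = p i then z else 0) - K i (p i)))" for K
  proof -
    let ?A = "mat n n (\<lambda>(i, j). K i j)"
    have "poly (charpoly n K) z = det (- (char_matrix ?A z))"
      using char_poly_matrix[of ?A n z] by simp
    also have "\<dots> = (\<Sum>p | p permutes {0..<n}.
      signof p * (\<Prod>i = 0..<n. (- char_matrix ?A z) $$ (i, p i)))"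
      by (rule det_def'[of _ n]) simp
    also have "\<dots> = (\<Sum>p | p permutes {0..<n}.
      signof p * (\<Prod>i = 0..<n. (if i = p i then z else 0) - K i (p i)))"
      by (intro sum.cong prod.cong arg_cong2[where f = "(*)"] refl)
         (auto simp: char_matrix_def permutes_in_image)
    finally show ?thesis .
  qed
  show ?thesis unfolding eq
    by (intro tendsto_intros assms) (auto simp: permutes_in_image)
qed

text \<open>Perturbing the diagonal in a Schur basis separates the eigenvalues.\<close>

lemma charpoly_schur_perturbation:
  obtains es D where "length es = n" "charpoly n G = (\<Prod>e\<leftarrow>es. [:- e, 1:])"
    "(\<Sum>i<n. G i i) = sum_list es"
    "\<And>t. charpoly n (\<lambda>i j. G i j + t * D i j) = (\<Prod>i\<leftarrow>[0..<n]. [:- (es ! i + t * of_nat (i + 1)), 1:])"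
proof -
  let ?A = "mat n n (\<lambda>(i, j). G i j)"
  have A: "?A \<in> carrier_mat n n" by simp
  obtain es where es: "charpoly n G = (\<Prod>e\<leftarrow>es. [:- e, 1:])" "length es = n"
    by (rule charpoly_factorization)
  obtain B P Q where "schur_decomposition ?A es = (B, P, Q)"
    by (cases "schur_decomposition ?A es")
  from schur_decomposition[OF A es(1) this]
  have w: "similar_mat_wit ?A B P Q" and ut: "upper_triangular B" and dg: "diag_mat B = es" by auto
  note wD = similar_mat_witD2[OF A w]
  \<comment> \<open>The diagonal entries 1, ..., n are distinct, which separates coinciding
    eigenvalues, and they avoid 0, which also moves zero eigenvalues off zero.\<close>
  define E where "E = mat n n (\<lambda>(i, j). if i = j then of_nat (i + 1) else (0::complex))"
  have E: "E \<in> carrier_mat n n" by (simp add: E_def)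
  define D where "D = P * E * Q"
  have D: "D \<in> carrier_mat n n" using wD E by (auto simp: D_def)
  have esi: "es ! i = B $$ (i, i)" if "i < n" for i
    using that dg wD(5) by (auto simp: diag_mat_def)
  have tr: "(\<Sum>i<n. G i i) = sum_list es"
  proof -
    have "(\<Sum>i<n. G i i) = (\<Sum>i<n. (P * B * Q) $$ (i, i))"
      unfolding wD(3)[symmetric] by simp
    also have "\<dots> = (\<Sum>i<n. \<Sum>j<n. (P * B) $$ (i, j) * Q $$ (j, i))"
      by (intro sum.cong refl index_mult_mat_sum[symmetric] index_mult_mat_sum) (use wD in auto)
    also have "\<dots> = (\<Sum>j<n. \<Sum>i<n. Q $$ (j, i) * (P * B) $$ (i, j))"
      by (subst sum.swap) (simp add: mult.commute)
    also have "\<dots> = (\<Sum>j<n. (Q * (P * B)) $$ (j, j))"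
      by (intro sum.cong refl index_mult_mat_sum[symmetric] index_mult_mat_sum) (use wD in auto)
    also have "Q * (P * B) = B"
      using wD assoc_mult_mat[OF wD(7) wD(6) wD(5)] by simp
    finally show ?thesis using es(2)
      by (simp add: sum_list_sum_nth atLeast0LessThan esi)
  qed
  have pert: "charpoly n (\<lambda>i j. G i j + t * D $$ (i, j)) =
    (\<Prod>i\<leftarrow>[0..<n]. [:- (es ! i + t * of_nat (i + 1)), 1:])" for t
  proof -
    let ?T = "B + t \<cdot>\<^sub>m E"
    have T: "?T \<in> carrier_mat n n" using wD E by auto
    have "mat n n (\<lambda>(i, j). G i j + t * D $$ (i, j)) = ?A + t \<cdot>\<^sub>m D"
      using D by (intro eq_matI) auto
    also have "\<dots> = P * ?T * Q"
    proof -
      have "P * ?T * Q = (P * B + P * (t \<cdot>\<^sub>m E)) * Q"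
        using wD E by (subst mult_add_distrib_mat[of _ n n]) auto
      also have "\<dots> = P * B * Q + P * (t \<cdot>\<^sub>m E) * Q"
        using wD E by (subst add_mult_distrib_mat[of _ n n]) auto
      also have "P * (t \<cdot>\<^sub>m E) * Q = t \<cdot>\<^sub>m D"
        using wD E mult_smult_distrib[OF wD(6) E, of t] mult_smult_assoc_mat[of "P * E" n n Q n t]
        by (auto simp: D_def)
      finally show ?thesis using wD(3) by simp
    qed
    finally have "similar_mat (mat n n (\<lambda>(i, j). G i j + t * D $$ (i, j))) ?T"
      using wD T by (intro similar_matI[of _ _ P Q n]) auto
    then have "charpoly n (\<lambda>i j. G i j + t * D $$ (i, j)) = char_poly ?T"
      by (rule char_poly_similar)
    also have "\<dots> = (\<Prod>a\<leftarrow>diag_mat ?T. [:- a, 1:])"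
    proof (rule char_poly_upper_triangular[OF T])
      show "upper_triangular ?T"
        using ut wD(5) unfolding upper_triangular_def by (auto simp: E_def)
    qed
    also have "diag_mat ?T = map (\<lambda>i. es ! i + t * of_nat (i + 1)) [0..<n]"
      using wD(5) by (auto simp: diag_mat_def E_def esi)
    finally show ?thesis by (simp add: o_def)
  qed
  show thesis by (rule that[OF es(2) es(1) tr pert])
qed

lemma charpoly_cong:
  assumes "\<And>i j. i < n \<Longrightarrow> j < n \<Longrightarrow> G i j = H i j"
  shows "charpoly n G = charpoly n H"
proof -
  have "mat n n (\<lambda>(i, j). G i j) = mat n n (\<lambda>(i, j). H i j)"
    by (rule eq_matI) (use assms in auto)
  then show ?thesis by simp
qed

lemma charpoly_nonzero: "charpoly n G \<noteq> 0"
  using degree_monic_char_poly[of "mat n n (\<lambda>(i, j). G i j)" n] by auto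

lemma degree_charpoly: "degree (charpoly n G) = n"
  using degree_monic_char_poly[of "mat n n (\<lambda>(i, j). G i j)" n] by auto

text \<open>Bolzano-Weierstrass one coordinate at a time: each new coordinate is handled on a
  subsequence of the previous one, which keeps the earlier limits.\<close>

lemma bounded_sequence_tuple_subsequence:
  fixes b :: "nat \<Rightarrow> nat \<Rightarrow> complex"
  assumes "\<And>k i. i < n \<Longrightarrow> cmod (b k i) \<le> C"
  shows "\<exists>s \<beta>. strict_mono s \<and> (\<forall>i<n. (\<lambda>k. b (s k) i) \<longlonglongrightarrow> \<beta> i)"
  using assms
proof (induction n)
    case 0
    show ?case by (auto intro: strict_mono_id)
  next
    case (Suc n)
    then obtain s \<beta> where s: "strict_mono s" "\<And>i. i < n \<Longrightarrow> (\<lambda>k. b (s k) i) \<longlonglongrightarrow> \<beta> i" by force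
    have "bounded (range (\<lambda>k. b (s k) n))"
      using Suc.prems unfolding bounded_iff by (intro exI[of _ C]) auto
    then obtain l r where r: "strict_mono r" "((\<lambda>k. b (s k) n) \<circ> r) \<longlonglongrightarrow> l"
      using bounded_imp_convergent_subsequence by blast
    have "(\<lambda>k. b ((s \<circ> r) k) i) \<longlonglongrightarrow> (\<beta>(n := l)) i" if "i < Suc n" for i
    proof (cases "i = n")
      case False
      then show ?thesis using LIMSEQ_subseq_LIMSEQ[OF s(2)[of i] r(1)] that by (simp add: o_def)
    qed (use r(2) in \<open>simp add: o_def\<close>)
    then show ?case using strict_mono_o[OF s(1) r(1)] by blast
qed

text \<open>The order of a root depends on the polynomial alone, so two factorizations of one
  polynomial have equal counts for each root, however the roots are listed.\<close>

lemma order_prod_linear: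
  fixes \<alpha> :: "nat \<Rightarrow> complex"
  shows "Polynomial.order w (\<Prod>i<n. [:- \<alpha> i, 1:]) = card {i. i < n \<and> \<alpha> i = w}"
proof (induction n)
  case 0
  show ?case by (simp add: order_0I)
next
  case (Suc n)
  have nz: "(\<Prod>i<n. [:- \<alpha> i, 1:]) * [:- \<alpha> n, 1:] \<noteq> 0"
    by (simp only: mult_eq_0_iff prod_zero_iff finite_lessThan) simp
  have order_n: "Polynomial.order w [:- \<alpha> n, 1:] = (if \<alpha> n = w then 1 else 0)"
    using order_power_n_n[of w 1] by (auto intro: order_0I)
  show ?case
  proof (cases "\<alpha> n = w")
    case True
    then have "{i. i < Suc n \<and> \<alpha> i = w} = insert n {i. i < n \<and> \<alpha> i = w}"
      by (auto simp: less_Suc_eq)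
    then have "card {i. i < Suc n \<and> \<alpha> i = w} = card {i. i < n \<and> \<alpha> i = w} + 1" by simp
    then show ?thesis
      unfolding prod.lessThan_Suc order_mult[OF nz] Suc.IH order_n using True by (simp only: if_True refl)
  next
    case False
    then have "{i. i < Suc n \<and> \<alpha> i = w} = {i. i < n \<and> \<alpha> i = w}"
      by (auto simp: less_Suc_eq)
    then show ?thesis
      unfolding prod.lessThan_Suc order_mult[OF nz] Suc.IH order_n using False by (simp only: if_False add_0_right refl)
  qed
qed

text \<open>Bounded roots have a convergent subsequence; the limit tuple factors the limit
  polynomial, hence is a rearrangement of \<open>\<alpha>\<close>. One index \<open>k\<close>
  suffices because the lemma is applied to a sequence all of whose terms are supposed to have the
  wrong count.\<close>

lemma root_count_limit:
  fixes b :: "nat \<Rightarrow> nat \<Rightarrow> complex"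
  assumes bound: "\<And>k i. i < n \<Longrightarrow> cmod (b k i) \<le> C"
    and lim: "\<And>z. (\<lambda>k. \<Prod>i<n. z - b k i) \<longlonglongrightarrow> (\<Prod>i<n. z - \<alpha> i)"
    and r: "r > 0" and iso: "\<And>i. i < n \<Longrightarrow> \<alpha> i \<in> cball w r \<Longrightarrow> \<alpha> i = w"
  shows "\<exists>k. card {i. i < n \<and> b k i \<in> ball w r} = card {i. i < n \<and> \<alpha> i = w}"
proof -
  obtain s \<beta> where s: "strict_mono s" "\<And>i. i < n \<Longrightarrow> (\<lambda>k. b (s k) i) \<longlonglongrightarrow> \<beta> i"
    using bounded_sequence_tuple_subsequence[of n b C, OF bound] by blast
  have "(\<Prod>i<n. z - \<beta> i) = (\<Prod>i<n. z - \<alpha> i)" for z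
  proof (rule LIMSEQ_unique)
    show "(\<lambda>k. \<Prod>i<n. z - b (s k) i) \<longlonglongrightarrow> (\<Prod>i<n. z - \<beta> i)"
      by (intro tendsto_intros s(2)) auto
    show "(\<lambda>k. \<Prod>i<n. z - b (s k) i) \<longlonglongrightarrow> (\<Prod>i<n. z - \<alpha> i)"
      using LIMSEQ_subseq_LIMSEQ[OF lim s(1)] by (simp add: o_def)
  qed
  then have "poly (\<Prod>i<n. [:- \<beta> i, 1:]) z = poly (\<Prod>i<n. [:- \<alpha> i, 1:]) z" for z
    by (simp add: poly_prod)
  then have eq: "(\<Prod>i<n. [:- \<beta> i, 1:]) = (\<Prod>i<n. [:- \<alpha> i, 1:])"
    by (simp only: poly_eq_poly_eq_iff[symmetric] fun_eq_iff) simp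
  then have count: "card {i. i < n \<and> \<beta> i = v} = card {i. i < n \<and> \<alpha> i = v}" for v
    by (metis order_prod_linear)
  have \<beta>_iso: "\<beta> i = w" if "i < n" "\<beta> i \<in> cball w r" for i
  proof -
    have "card {j. j < n \<and> \<beta> j = \<beta> i} > 0" using that by (subst card_gt_0_iff) auto
    then have "card {j. j < n \<and> \<alpha> j = \<beta> i} > 0" by (simp add: count)
    then obtain j where "j < n" "\<alpha> j = \<beta> i" by (auto simp: card_gt_0_iff)
    then show ?thesis using iso[of j] that by simp
  qed
  \<comment> \<open>Limits equal to \<open>w\<close> lie in the open ball and all others lie outside
    the closed ball; both conditions are open, so they hold eventually along the
    subsequence.\<close>
  have "\<forall>\<^sub>F k in sequentially. b (s k) i \<in> ball w r \<longleftrightarrow> \<beta> i = w" if "i < n" for i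
  proof (cases "\<beta> i = w")
    case True
    then have "\<forall>\<^sub>F k in sequentially. b (s k) i \<in> ball w r"
      by (intro topological_tendstoD[OF s(2)[OF that]]) (use r in auto)
    then show ?thesis using True by simp
  next
    case False
    then have "\<forall>\<^sub>F k in sequentially. b (s k) i \<in> - cball w r"
      by (intro topological_tendstoD[OF s(2)[OF that]]) (use \<beta>_iso[OF that] in auto)
    then show ?thesis by eventually_elim (use False in auto)
  qed
  then have "\<forall>\<^sub>F k in sequentially. \<forall>i\<in>{..<n}. b (s k) i \<in> ball w r \<longleftrightarrow> \<beta> i = w"
    by (intro eventually_ball_finite) auto
  then obtain k where k: "\<forall>i\<in>{..<n}. b (s k) i \<in> ball w r \<longleftrightarrow> \<beta> i = w"
    using eventually_happens'[OF sequentially_bot] by blast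
  then have "{i. i < n \<and> b (s k) i \<in> ball w r} = {i. i < n \<and> \<beta> i = w}" by auto
  then show ?thesis using count by metis
qed

subsection \<open>Invertibility and the spectrum\<close>

interpretation scaleC: vector_space "scaleC :: complex \<Rightarrow> 'a::complex_banach_algebra_1 \<Rightarrow> 'a"
  by standard (rule scaleC_add_right scaleC_add_left scaleC_scaleC scaleC_one)+

declare mult_scaleC_left [simp] mult_scaleC_right [simp]

text \<open>The exponent starts at one because \<open>norm 1\<close> may exceed 1.\<close>

lemma norm_power_Suc_le: "norm (x ^ Suc n) \<le> norm (x :: 'a::complex_banach_algebra_1) ^ Suc n"
proof (induction n)
  case (Suc n)
  have "norm (x ^ Suc (Suc n)) \<le> norm x * norm (x ^ Suc n)"
    using norm_mult_ineq[of x "x ^ Suc n"] by simp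
  also have "\<dots> \<le> norm x * norm x ^ Suc n"
    by (intro mult_left_mono Suc.IH) auto
  finally show ?case by simp
qed simp

lemma neumann_inverse:
  fixes u :: "'a::complex_banach_algebra_1"
  assumes "norm u < 1"
  obtains y where "(1 - u) * y = 1" "y * (1 - u) = 1"
proof -
  have "summable (\<lambda>n. norm u ^ Suc n)"
    using assms by (subst summable_Suc_iff) (simp add: summable_geometric)
  then have "summable (\<lambda>n. u ^ Suc n)"
    using norm_power_Suc_le by (rule summable_comparison_test'[where N = 0])
  then have sm: "summable (\<lambda>n. u ^ n)" by (subst (asm) summable_Suc_iff)
  have 0: "suminf (\<lambda>n. u ^ n) = 1 + suminf (\<lambda>n. u ^ Suc n)"
    using suminf_split_head[OF sm] by simp
  have "u * suminf (\<lambda>n. u ^ n) = suminf (\<lambda>n. u ^ Suc n)"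
    using suminf_mult[OF sm, of u] by simp
  moreover have "suminf (\<lambda>n. u ^ n) * u = suminf (\<lambda>n. u ^ Suc n)"
    using suminf_mult2[OF sm, of u] by (simp add: power_commutes)
  ultimately show thesis
    using 0 by (intro that[of "suminf (\<lambda>n. u ^ n)"]) (simp_all add: algebra_simps)
qed

lemma spectrum_memI_right:
  fixes a v :: "'a::complex_banach_algebra_1"
  assumes "a * v = z *\<^sub>C v" "v \<noteq> 0"
  shows "z \<in> spectrum a"
proof (rule ccontr)
  assume "z \<notin> spectrum a"
  then obtain y where "y * (z *\<^sub>C 1 - a) = 1" unfolding spectrum_def by auto
  then have "v = y * ((z *\<^sub>C 1 - a) * v)" using mult.assoc[of y "z *\<^sub>C 1 - a" v] by simp
  also have "(z *\<^sub>C 1 - a) * v = 0" using assms(1) by (simp add: left_diff_distrib)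
  finally show False using assms(2) by simp
qed

lemma not_in_spectrumI:
  fixes a :: "'a::complex_banach_algebra_1"
  assumes "(z *\<^sub>C 1 - a) * y = 1" "y * (z *\<^sub>C 1 - a) = 1"
  shows "z \<notin> spectrum a"
  using assms unfolding spectrum_def by auto

lemma zero_in_spectrum_iff:
  "0 \<in> spectrum (a :: 'a::complex_banach_algebra_1) \<longleftrightarrow> \<not> (\<exists>y. a * y = 1 \<and> y * a = 1)"
proof -
  have "(\<exists>y. - (a * y) = 1 \<and> - (y * a) = 1) \<longleftrightarrow> (\<exists>y. a * y = 1 \<and> y * a = 1)"
    by (intro iffI; elim exE, rule_tac x = "- y" in exI) auto
  then show ?thesis unfolding spectrum_def
    by (simp only: mem_Collect_eq scaleC.scale_zero_left diff_0 mult_minus_left mult_minus_right)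
qed

lemma spectrum_norm_le:
  fixes a :: "'a::complex_banach_algebra_1"
  assumes "z \<in> spectrum a"
  shows "cmod z \<le> norm a"
proof (rule ccontr)
  assume *: "\<not> cmod z \<le> norm a"
  then have z: "z \<noteq> 0" by auto
  have "norm (inverse z *\<^sub>C a) = norm a / cmod z"
    by (simp add: norm_scaleC norm_inverse divide_inverse mult.commute)
  also have "\<dots> < 1" using * z by simp
  finally have "norm (inverse z *\<^sub>C a) < 1" .
  then obtain y where y: "(1 - inverse z *\<^sub>C a) * y = 1" "y * (1 - inverse z *\<^sub>C a) = 1"
    by (rule neumann_inverse)
  have eq: "z *\<^sub>C 1 - a = z *\<^sub>C (1 - inverse z *\<^sub>C a)"
    using z by (simp add: scaleC.scale_right_diff_distrib)
  have "z \<notin> spectrum a"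
    by (rule not_in_spectrumI[of _ _ "inverse z *\<^sub>C y"]) (use y z in \<open>simp_all add: eq\<close>)
  then show False using assms by simp
qed

subsection \<open>Maximal left ideals\<close>

lemma left_idealD:
  assumes "left_ideal M"
  shows "0 \<in> M" "x \<in> M \<Longrightarrow> y \<in> M \<Longrightarrow> x + y \<in> M" "x \<in> M \<Longrightarrow> a * x \<in> M"
    "x \<in> M \<Longrightarrow> - x \<in> M" "x \<in> M \<Longrightarrow> y \<in> M \<Longrightarrow> x - y \<in> M"
proof -
  show *: "0 \<in> M" "x \<in> M \<Longrightarrow> y \<in> M \<Longrightarrow> x + y \<in> M" "x \<in> M \<Longrightarrow> a * x \<in> M" for x y a
    using assms by (auto simp: left_ideal_def)
  show **: "x \<in> M \<Longrightarrow> - x \<in> M" for x using *(3)[of x "-1"] by simp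
  show "x \<in> M \<Longrightarrow> y \<in> M \<Longrightarrow> x - y \<in> M" using *(2)[of x "- y"] **[of y] by simp
qed

lemma left_ideal_scaleC:
  fixes M :: "'a::complex_banach_algebra_1 set"
  assumes "left_ideal M" "x \<in> M"
  shows "c *\<^sub>C x \<in> M"
  using left_idealD(3)[OF assms, of "c *\<^sub>C 1"] by simp

lemma left_ideal_sum:
  assumes "left_ideal M" "\<And>i. i \<in> I \<Longrightarrow> f i \<in> M"
  shows "sum f I \<in> M"
  using assms(2) by (induction I rule: infinite_finite_induct) (auto simp: left_idealD[OF assms(1)])

locale max_left_ideal =
  fixes M :: "'a::complex_banach_algebra_1 set"
  assumes maximal: "maximal_left_ideal M"
begin

lemma left_ideal: "left_ideal M" and proper: "M \<noteq> UNIV"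
  using maximal by (simp_all add: maximal_left_ideal_def)

lemmas zero_mem = left_idealD(1)[OF left_ideal]
lemmas add_mem = left_idealD(2)[OF left_ideal]
lemmas mult_mem = left_idealD(3)[OF left_ideal]
lemmas uminus_mem = left_idealD(4)[OF left_ideal]
lemmas diff_mem = left_idealD(5)[OF left_ideal]
lemmas scaleC_mem = left_ideal_scaleC[OF left_ideal]
lemmas sum_mem = left_ideal_sum[OF left_ideal]

lemma one_not_mem: "1 \<notin> M"
  using mult_mem[of 1] proper by auto

lemma diff_mem_sym: "x - y \<in> M \<Longrightarrow> y - x \<in> M"
  using uminus_mem[of "x - y"] by simp

lemma mem_cong: "x - y \<in> M \<Longrightarrow> x \<in> M \<longleftrightarrow> y \<in> M"
  using add_mem[of "x - y" y] diff_mem[of x "x - y"] by auto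

text \<open>Simplicity of A / M: the left ideal A v + M is strictly larger than \<open>M\<close>,
  hence contains 1.\<close>

lemma left_inverse_mod:
  assumes "v \<notin> M"
  obtains y where "y * v - 1 \<in> M"
proof -
  define J where "J = {a * v + m | a m. m \<in> M}"
  have "left_ideal J"
    unfolding left_ideal_def
  proof (intro conjI ballI allI)
    show "0 \<in> J" unfolding J_def using zero_mem by (intro CollectI exI[of _ 0]) simp
  next
    fix x y assume "x \<in> J" "y \<in> J"
    then obtain a m b l where "x = a * v + m" "m \<in> M" "y = b * v + l" "l \<in> M"
      by (auto simp: J_def)
    then have "x + y = (a + b) * v + (m + l)" "m + l \<in> M"
      by (auto simp: algebra_simps add_mem)
    then show "x + y \<in> J" unfolding J_def by blast
  next
    fix c x assume "x \<in> J"
    then obtain a m where "x = a * v + m" "m \<in> M"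
      by (auto simp: J_def)
    then have "c * x = (c * a) * v + c * m" "c * m \<in> M"
      by (auto simp: algebra_simps mult_mem)
    then show "c * x \<in> J" unfolding J_def by blast
  qed
  moreover have "m \<in> J" if "m \<in> M" for m
    unfolding J_def using that by (intro CollectI exI[of _ 0] exI[of _ m]) simp
  then have "M \<subseteq> J" by blast
  moreover have "v \<in> J" unfolding J_def using zero_mem by (intro CollectI exI[of _ 1] exI[of _ 0]) simp
  ultimately have "J = UNIV" using maximal assms by (auto simp: maximal_left_ideal_def)
  then obtain a m where "1 = a * v + m" "m \<in> M" unfolding J_def by blast
  then have "a * v - 1 = - m" by (simp add: algebra_simps)
  then show thesis using that[of a] uminus_mem[OF \<open>m \<in> M\<close>] by simp
qed

text \<open>The quotient norm of A / M, pulled back to the algebra; computations in A / M are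
  carried out with representatives modulo \<open>M\<close>.\<close>

definition dist_mod :: "'a \<Rightarrow> real" where
  "dist_mod x = (INF m\<in>M. norm (x - m))"

lemma dist_mod_le: "m \<in> M \<Longrightarrow> dist_mod x \<le> norm (x - m)"
  unfolding dist_mod_def by (intro cINF_lower bdd_belowI2[where m = 0]) auto

lemma dist_mod_greatest: "(\<And>m. m \<in> M \<Longrightarrow> c \<le> norm (x - m)) \<Longrightarrow> c \<le> dist_mod x"
  unfolding dist_mod_def using zero_mem by (intro cINF_greatest) auto

lemma dist_mod_nonneg: "dist_mod x \<ge> 0"
  by (rule dist_mod_greatest) simp

lemma dist_mod_le_norm: "dist_mod x \<le> norm x"
  using dist_mod_le[OF zero_mem, of x] by simp

lemma dist_mod_approx:
  assumes "dist_mod x < c"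
  obtains m where "m \<in> M" "norm (x - m) < c"
  using assms dist_mod_greatest[of c x] that by fastforce

lemma dist_mod_cong:
  assumes "x - y \<in> M"
  shows "dist_mod x = dist_mod y"
proof -
  have "dist_mod x \<le> dist_mod y" if "x - y \<in> M" for x y
  proof (rule dist_mod_greatest)
    fix m assume "m \<in> M"
    then show "dist_mod x \<le> norm (y - m)"
      using dist_mod_le[OF add_mem[OF that \<open>m \<in> M\<close>], of x] by simp
  qed
  from this[OF assms] this[OF diff_mem_sym[OF assms]] show ?thesis by simp
qed

lemma dist_mod_triangle: "dist_mod (x + y) \<le> dist_mod x + dist_mod y"
proof (rule field_le_epsilon)
  fix e :: real assume "e > 0"
  obtain m where m: "m \<in> M" "norm (x - m) < dist_mod x + e / 2"
    by (rule dist_mod_approx[of x "dist_mod x + e / 2"]) (use \<open>e > 0\<close> in auto)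
  obtain l where l: "l \<in> M" "norm (y - l) < dist_mod y + e / 2"
    by (rule dist_mod_approx[of y "dist_mod y + e / 2"]) (use \<open>e > 0\<close> in auto)
  have "dist_mod (x + y) \<le> norm ((x - m) + (y - l))"
    using dist_mod_le[OF add_mem[OF m(1) l(1)], of "x + y"] by (simp add: algebra_simps)
  also have "\<dots> \<le> norm (x - m) + norm (y - l)" by (rule norm_triangle_ineq)
  finally show "dist_mod (x + y) \<le> dist_mod x + dist_mod y + e" using m l by simp
qed

lemma dist_mod_scaleC_le: "dist_mod (c *\<^sub>C x) \<le> cmod c * dist_mod x"
proof (cases "c = 0")
  case False
  have "dist_mod (c *\<^sub>C x) / cmod c \<le> dist_mod x"
  proof (rule dist_mod_greatest)
    fix m assume "m \<in> M"
    have "dist_mod (c *\<^sub>C x) \<le> norm (c *\<^sub>C x - c *\<^sub>C m)"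
      by (rule dist_mod_le[OF scaleC_mem[OF \<open>m \<in> M\<close>]])
    also have "\<dots> = cmod c * norm (x - m)"
      by (simp add: norm_scaleC flip: scaleC.scale_right_diff_distrib)
    finally show "dist_mod (c *\<^sub>C x) / cmod c \<le> norm (x - m)"
      using False by (simp add: field_simps)
  qed
  then show ?thesis using False by (simp add: field_simps)
qed (use dist_mod_le_norm[of 0] in simp)

lemma dist_mod_sum: "dist_mod (sum f I) \<le> (\<Sum>i\<in>I. dist_mod (f i))"
proof (induction I rule: infinite_finite_induct)
  case (insert i I)
  then show ?case using dist_mod_triangle[of "f i" "sum f I"] by simp
qed (use dist_mod_le_norm[of 0] dist_mod_nonneg in auto)

text \<open>Right multiplication by \<open>c\<close> induces a map on A / M exactly for these
  \<open>c\<close>, and such a map commutes with the left action. They form a subalgebra in which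
  \<open>M\<close> is a two-sided ideal.\<close>

definition idealizer :: "'a set" where
  "idealizer = {c. \<forall>m\<in>M. m * c \<in> M}"

lemma idealizer_mult: "c \<in> idealizer \<Longrightarrow> d \<in> idealizer \<Longrightarrow> c * d \<in> idealizer"
  unfolding idealizer_def by (auto simp flip: mult.assoc)

lemma idealizer_add: "c \<in> idealizer \<Longrightarrow> d \<in> idealizer \<Longrightarrow> c + d \<in> idealizer"
  unfolding idealizer_def by (auto simp: distrib_left add_mem)

lemma idealizer_diff: "c \<in> idealizer \<Longrightarrow> d \<in> idealizer \<Longrightarrow> c - d \<in> idealizer"
  unfolding idealizer_def by (auto simp: right_diff_distrib diff_mem)

lemma idealizer_scaleC: "c \<in> idealizer \<Longrightarrow> z *\<^sub>C c \<in> idealizer"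
  unfolding idealizer_def by (auto simp: scaleC_mem)

lemma one_idealizer: "1 \<in> idealizer"
  unfolding idealizer_def by auto

text \<open>For m and l in \<open>M\<close> the product (x - m)(y - l) differs from x y by m y + (x
  - m) l. The second term lies in the left ideal, the first because \<open>y\<close> is in the
  idealizer.\<close>

lemma dist_mod_mult_le:
  assumes "y \<in> idealizer"
  shows "dist_mod (x * y) \<le> dist_mod x * dist_mod y"
proof (rule field_le_epsilon)
  fix e :: real assume "e > 0"
  have "((\<lambda>t. (dist_mod x + t) * (dist_mod y + t)) \<longlongrightarrow> (dist_mod x + 0) * (dist_mod y + 0)) (at_right 0)"
    by (intro tendsto_intros)
  then have "\<forall>\<^sub>F t in at_right 0. (dist_mod x + t) * (dist_mod y + t) < dist_mod x * dist_mod y + e"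
    by (rule order_tendstoD) (use \<open>e > 0\<close> in simp)
  then have "\<forall>\<^sub>F t in at_right 0. t > 0 \<and> (dist_mod x + t) * (dist_mod y + t) < dist_mod x * dist_mod y + e"
    using eventually_at_right_less by (rule eventually_conj[rotated])
  then obtain t where t: "t > 0" "(dist_mod x + t) * (dist_mod y + t) < dist_mod x * dist_mod y + e"
    using eventually_happens'[OF trivial_limit_at_right_real] by blast
  obtain m where m: "m \<in> M" "norm (x - m) < dist_mod x + t"
    by (rule dist_mod_approx[of x "dist_mod x + t"]) (use \<open>t > 0\<close> in auto)
  obtain l where l: "l \<in> M" "norm (y - l) < dist_mod y + t"
    by (rule dist_mod_approx[of y "dist_mod y + t"]) (use \<open>t > 0\<close> in auto)
  have "m * y \<in> M" using assms m(1) unfolding idealizer_def by auto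
  then have "m * y + (x - m) * l \<in> M" using mult_mem[OF l(1)] by (rule add_mem)
  then have "dist_mod (x * y) \<le> norm (x * y - (m * y + (x - m) * l))" by (rule dist_mod_le)
  also have "x * y - (m * y + (x - m) * l) = (x - m) * (y - l)" by (simp add: algebra_simps)
  also have "norm \<dots> \<le> norm (x - m) * norm (y - l)" by (rule norm_mult_ineq)
  also have "\<dots> \<le> (dist_mod x + t) * (dist_mod y + t)"
    using m l dist_mod_nonneg[of x] t by (intro mult_mono) auto
  finally show "dist_mod (x * y) \<le> dist_mod x * dist_mod y + e" using t(2) by simp
qed

text \<open>The seminorm of 1 is at least 1, since an element of \<open>M\<close> at distance below
  1 from 1 would be invertible. A left inverse of \<open>v\<close> modulo \<open>M\<close> carries
  this bound over to \<open>v\<close>.\<close>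

lemma dist_mod_pos:
  assumes "v \<in> idealizer" "v \<notin> M"
  shows "dist_mod v > 0"
proof -
  obtain y where y: "y * v - 1 \<in> M" using left_inverse_mod[OF assms(2)] .
  have "1 \<le> dist_mod 1"
  proof (rule dist_mod_greatest, rule ccontr)
    fix m assume "m \<in> M" "\<not> 1 \<le> norm (1 - m)"
    then have "norm (1 - m) < 1" by simp
    then obtain u where "u * (1 - (1 - m)) = 1" by (rule neumann_inverse)
    then have "1 \<in> M" using mult_mem[OF \<open>m \<in> M\<close>, of u] by simp
    then show False using one_not_mem by simp
  qed
  also have "dist_mod 1 = dist_mod (y * v)" by (rule dist_mod_cong[symmetric, OF y])
  also have "\<dots> \<le> dist_mod y * dist_mod v" by (rule dist_mod_mult_le[OF assms(1)])
  finally show ?thesis using dist_mod_nonneg[of v] by (cases "dist_mod v = 0") auto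
qed

text \<open>Schur's lemma. If x c is in \<open>M\<close> and u x is 1 modulo \<open>M\<close>, then
  \<open>c\<close> itself is in \<open>M\<close>; so right multiplication by \<open>c\<close> is
  injective modulo \<open>M\<close>. Cancelling \<open>c\<close> shows that the left inverse lies in
  the idealizer and is also a right inverse.\<close>

lemma idealizer_inverse:
  assumes c: "c \<in> idealizer" "c \<notin> M"
  obtains y where "y \<in> idealizer" "y * c - 1 \<in> M" "c * y - 1 \<in> M"
proof -
  obtain y where y: "y * c - 1 \<in> M" using left_inverse_mod[OF c(2)] .
  have ker: "x \<in> M" if "x * c \<in> M" for x
  proof (rule ccontr)
    assume "x \<notin> M"
    then obtain u where u: "u * x - 1 \<in> M" by (rule left_inverse_mod)
    then have "(u * x - 1) * c \<in> M" using c(1) by (auto simp: idealizer_def)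
    then have *: "u * (x * c) - c \<in> M" by (simp add: algebra_simps)
    then show False using mem_cong[OF *] mult_mem[OF that, of u] c(2) by simp
  qed
  have "y \<in> idealizer" unfolding idealizer_def
  proof (intro CollectI ballI)
    fix m assume m: "m \<in> M"
    have "m * (y * c - 1) \<in> M" by (rule mult_mem[OF y])
    then have *: "m * y * c - m \<in> M" by (simp add: algebra_simps)
    then have "m * y * c \<in> M" using m mem_cong[OF *] by simp
    then show "m * y \<in> M" by (rule ker)
  qed
  moreover have "c * y - 1 \<in> M"
    by (rule ker, insert mult_mem[OF y, of c]) (simp add: algebra_simps)
  ultimately show thesis using y that by blast
qed

end

section \<open>Averaging over roots of unity; the Gelfand-Mazur theorem for the commutant\<close>

lemma sum_powers_root_of_unity:
  fixes n j :: nat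
  assumes "j < n"
  shows "(\<Sum>k<n. (exp (2 * of_real pi * \<i> * of_nat j / of_nat n) :: complex) ^ k) = (if j = 0 then of_nat n else 0)"
proof -
  let ?w = "exp (2 * of_real pi * \<i> * of_nat j / of_nat n) :: complex"
  have "?w = 1 \<longleftrightarrow> n dvd j" using complex_root_unity_eq_1[of n j] assms by simp
  also have "\<dots> \<longleftrightarrow> j = 0" using assms by (auto dest: dvd_imp_le)
  finally have 1: "?w = 1 \<longleftrightarrow> j = 0" .
  have "?w ^ n = exp (2 * of_real pi * \<i> * of_nat j)"
    using assms by (simp flip: exp_of_nat_mult)
  also have "\<dots> = 1"
    using complex_root_unity_eq_1[of 1 j] by simp
  finally have 2: "?w ^ n = 1" .
  show ?thesis unfolding sum_gp_strict using 1 2 by simp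
qed

lemma scaleC_power: "(z *\<^sub>C x) ^ n = (z ^ n) *\<^sub>C (x ^ n :: 'a::complex_banach_algebra_1)"
  by (induction n) (simp_all add: mult.commute)

lemma geometric_identity:
  fixes x :: "'a::ring_1"
  shows "(1 - x) * (\<Sum>j<n. x ^ j) = 1 - x ^ n"
proof (induction n)
  case (Suc n)
  then show ?case by (simp add: distrib_left left_diff_distrib)
qed simp

context max_left_ideal
begin

lemma idealizer_mem_mult: "m \<in> M \<Longrightarrow> c \<in> idealizer \<Longrightarrow> m * c \<in> M"
  by (auto simp: idealizer_def)

lemma idealizer_power: "c \<in> idealizer \<Longrightarrow> c ^ n \<in> idealizer"
  by (induction n) (auto simp: one_idealizer idealizer_mult)

lemma idealizer_sum: "(\<And>i. i \<in> I \<Longrightarrow> f i \<in> idealizer) \<Longrightarrow> sum f I \<in> idealizer"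
proof (induction I rule: infinite_finite_induct)
  case (insert i I)
  then show ?case by (simp add: idealizer_add)
qed (use idealizer_diff[OF one_idealizer one_idealizer] in auto)

lemma dist_mod_power_le:
  assumes "c \<in> idealizer" "n > 0"
  shows "dist_mod (c ^ n) \<le> dist_mod c ^ n"
  using assms(2)
proof (induction n rule: nat_induct_non_zero)
  case (Suc n)
  have "dist_mod (c * c ^ n) \<le> dist_mod c * dist_mod (c ^ n)"
    by (rule dist_mod_mult_le[OF idealizer_power[OF assms(1)]])
  also have "\<dots> \<le> dist_mod c * dist_mod c ^ n"
    by (intro mult_left_mono Suc dist_mod_nonneg)
  finally show ?case by simp
qed simp

lemma dist_mod_uminus: "dist_mod (- x) \<le> dist_mod x"
  using dist_mod_scaleC_le[of "-1" x] by simp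

lemma dist_mod_diff_le: "dist_mod x - dist_mod y \<le> dist_mod (x - y)"
  using dist_mod_triangle[of "x - y" y] by simp

text \<open>
  The algebra \<open>idealizer / M\<close> is the commutant of the irreducible module \<open>A / M\<close>. If \<open>c\<close> has
  empty spectrum in it, then the quotient norm of the resolvent has a maximum on the plane. At a
  maximum with largest real part, the mean over the vertices of a regular \<open>n\<close>-gon differs from the
  central value by an amount exponentially small in \<open>n\<close>, whereas one vertex alone lowers the
  mean by \<open>\<delta> / n\<close>.
\<close>

theorem idealizer_scalar_mod:
  assumes c: "c \<in> idealizer"
  obtains z where "c - z *\<^sub>C 1 \<in> M"
proof (rule ccontr)
  assume "\<not> thesis"
  then have nM: "c - z *\<^sub>C 1 \<notin> M" for z using that by blast
  have cz: "c - z *\<^sub>C 1 \<in> idealizer" for z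
    by (intro idealizer_diff c idealizer_scaleC one_idealizer)
  have "\<exists>y. y \<in> idealizer \<and> y * (c - z *\<^sub>C 1) - 1 \<in> M \<and> (c - z *\<^sub>C 1) * y - 1 \<in> M" for z
    using idealizer_inverse[OF cz nM] by metis
  then obtain r where rI: "\<And>z. r z \<in> idealizer"
    and rl: "\<And>z. r z * (c - z *\<^sub>C 1) - 1 \<in> M"
    and rr: "\<And>z. (c - z *\<^sub>C 1) * r z - 1 \<in> M" by metis
  define N where "N z = dist_mod (r z)" for z
  have N_pos: "N z > 0" for z
    unfolding N_def
  proof (rule dist_mod_pos[OF rI])
    show "r z \<notin> M"
    proof
      assume "r z \<in> M"
      then have "r z * (c - z *\<^sub>C 1) \<in> M" by (rule idealizer_mem_mult[OF _ cz])
      then show False using mem_cong[OF rl[of z]] one_not_mem by simp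
    qed
  qed
  have resolvent: "r w - r z - (w - z) *\<^sub>C (r w * r z) \<in> M" for w z
  proof -
    have "(r w * (c - w *\<^sub>C 1) - 1) * r z \<in> M"
      by (rule idealizer_mem_mult[OF rl rI])
    moreover have "r w * ((c - z *\<^sub>C 1) * r z - 1) \<in> M" by (rule mult_mem[OF rr])
    ultimately have "(r w * (c - w *\<^sub>C 1) - 1) * r z - r w * ((c - z *\<^sub>C 1) * r z - 1) \<in> M"
      by (rule diff_mem)
    moreover have "(r w * (c - w *\<^sub>C 1) - 1) * r z - r w * ((c - z *\<^sub>C 1) * r z - 1)
        = r w - r z - (w - z) *\<^sub>C (r w * r z)"
      by (simp add: algebra_simps scaleC.scale_left_diff_distrib)
    ultimately show ?thesis by simp
  qed
  have N_diff: "N w - N z \<le> cmod (w - z) * (N w * N z)" for w z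
  proof -
    have "N w - N z \<le> dist_mod (r w - r z)" unfolding N_def by (rule dist_mod_diff_le)
    also have "\<dots> = dist_mod ((w - z) *\<^sub>C (r w * r z))"
      by (rule dist_mod_cong) (use resolvent in simp)
    also have "\<dots> \<le> cmod (w - z) * dist_mod (r w * r z)" by (rule dist_mod_scaleC_le)
    also have "\<dots> \<le> cmod (w - z) * (N w * N z)"
      unfolding N_def by (intro mult_left_mono dist_mod_mult_le rI) auto
    finally show ?thesis .
  qed
  have N_cont: "isCont N z" for z
  proof -
    \<comment> \<open>For w close to z the factor \<open>N w\<close> is at most
      \<open>2 * N z\<close>, so the resolvent identity becomes a Lipschitz bound at z.\<close>
    have bound: "\<bar>N w - N z\<bar> \<le> cmod (w - z) * (2 * N z * N z)" if w: "cmod (w - z) * N z \<le> 1 / 2" for w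
    proof -
      have "N w * (cmod (w - z) * N z) \<le> N w * (1 / 2)"
        using w N_pos[of w] by (intro mult_left_mono) auto
      then have 2: "N w \<le> 2 * N z" using N_diff[of w z] by (simp add: algebra_simps)
      have "N w * N z \<le> 2 * N z * N z" using 2 N_pos[of z] by (intro mult_right_mono) auto
      then have "cmod (w - z) * (N w * N z) \<le> cmod (w - z) * (2 * N z * N z)"
        by (intro mult_left_mono) auto
      then show ?thesis using N_diff[of w z] N_diff[of z w]
        by (simp add: norm_minus_commute mult.commute)
    qed
    have "((\<lambda>w. cmod (w - z) * N z) \<longlongrightarrow> cmod (z - z) * N z) (at z)"
      by (intro tendsto_intros)
    then have "\<forall>\<^sub>F w in at z. cmod (w - z) * N z < 1 / 2"
      by (rule order_tendstoD) simp
    then have "\<forall>\<^sub>F w in at z. norm (N w - N z) \<le> cmod (w - z) * (2 * N z * N z)"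
      by eventually_elim (use bound in simp)
    moreover have "((\<lambda>w. cmod (w - z) * (2 * N z * N z)) \<longlongrightarrow> cmod (z - z) * (2 * N z * N z)) (at z)"
      by (intro tendsto_intros)
    ultimately have "((\<lambda>w. N w - N z) \<longlongrightarrow> 0) (at z)"
      using Lim_null_comparison[of "\<lambda>w. N w - N z"] by simp
    then show ?thesis unfolding isCont_def by (rule LIM_zero_cancel)
  qed
  have N_decay: "(cmod z - dist_mod c) * N z \<le> dist_mod 1" for z
  proof (cases "z = 0")
    case True
    then show ?thesis using N_pos[of 0] dist_mod_nonneg[of c] dist_mod_nonneg[of 1]
      by (simp add: mult_nonneg_nonneg add_increasing2 order_trans[OF _ dist_mod_nonneg])
  next
    case False
    have "N z = dist_mod (inverse z *\<^sub>C (z *\<^sub>C r z))" using False by (simp add: N_def)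
    also have "\<dots> \<le> cmod (inverse z) * dist_mod (z *\<^sub>C r z)" by (rule dist_mod_scaleC_le)
    finally have "cmod z * N z \<le> cmod z * (inverse (cmod z) * dist_mod (z *\<^sub>C r z))"
      by (intro mult_left_mono) (simp_all add: norm_inverse)
    then have "cmod z * N z \<le> dist_mod (z *\<^sub>C r z)"
      using False by (simp flip: mult.assoc)
    also have "dist_mod (z *\<^sub>C r z) = dist_mod (c * r z - 1)"
      by (rule dist_mod_cong, rule diff_mem_sym) (use rr[of z] in \<open>simp add: algebra_simps\<close>)
    also have "\<dots> \<le> dist_mod (c * r z) + dist_mod (- 1)"
      using dist_mod_triangle[of "c * r z" "- 1"] by simp
    also have "\<dots> \<le> dist_mod c * N z + dist_mod 1"
      unfolding N_def by (intro add_mono dist_mod_mult_le dist_mod_uminus rI)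
    finally show ?thesis by (simp add: algebra_simps)
  qed
  \<comment> \<open>Outside the open disc of radius \<open>R\<close>, \<open>N_decay\<close> forces
    \<open>N z\<close> below \<open>N 0\<close>, so a maximum over the closed disc is one over the
    plane.\<close>
  define R where "R = dist_mod c + dist_mod 1 / N 0 + 1"
  have R: "N z < N 0" if "cmod z \<ge> R" for z
  proof (rule ccontr)
    assume "\<not> N z < N 0"
    moreover have "cmod z - dist_mod c \<ge> dist_mod 1 / N 0 + 1" using that by (simp add: R_def)
    moreover have "dist_mod 1 / N 0 \<ge> 0" using N_pos[of 0] dist_mod_nonneg[of 1] by simp
    ultimately have "(dist_mod 1 / N 0 + 1) * N 0 \<le> (cmod z - dist_mod c) * N z"
      using N_pos[of 0] by (intro mult_mono) auto
    moreover have "(dist_mod 1 / N 0 + 1) * N 0 = dist_mod 1 + N 0"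
      using N_pos[of 0] by (simp add: distrib_right)
    ultimately show False using N_decay[of z] N_pos[of 0] by linarith
  qed
  have "R \<ge> 0" unfolding R_def using N_pos[of 0] dist_mod_nonneg by (simp add: add_nonneg_nonneg)
  have cont: "continuous_on S N" for S
    using N_cont by (simp add: continuous_at_imp_continuous_on)
  have "cball 0 R \<noteq> ({} :: complex set)" using \<open>R \<ge> 0\<close> by auto
  then obtain z1 where z1: "z1 \<in> cball 0 R" "\<forall>z\<in>cball 0 R. N z \<le> N z1"
    using continuous_attains_sup[OF compact_cball _ cont] by blast
  have max: "N z \<le> N z1" for z
  proof (cases "cmod z \<le> R")
    case False
    then have "N z < N 0" by (intro R) simp
    also have "N 0 \<le> N z1" using z1(2) \<open>R \<ge> 0\<close> by auto
    finally show ?thesis by simp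
  qed (use z1(2) in auto)
  define S where "S = {z. N z = N z1}"
  have "S \<subseteq> cball 0 R"
  proof
    fix z assume "z \<in> S"
    then have "\<not> N z < N 0" using z1(2) \<open>R \<ge> 0\<close> by (auto simp: S_def not_less)
    then have "\<not> cmod z \<ge> R" using R by blast
    then show "z \<in> cball 0 R" by simp
  qed
  then have "bounded S" using bounded_subset bounded_cball by blast
  moreover have "closed S" unfolding S_def
    by (intro closed_Collect_eq cont continuous_intros)
  ultimately have "compact S" by (simp add: compact_eq_bounded_closed)
  moreover have "S \<noteq> {}" unfolding S_def by auto
  moreover have "continuous_on S Re" by (intro continuous_on_Re continuous_on_id)
  ultimately obtain z0 where z0: "z0 \<in> S" "\<forall>z\<in>S. Re z \<le> Re z0"
    using continuous_attains_sup[of S Re] by blast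
  define m where "m = N z0"
  have m: "N z \<le> m" for z using max z0(1) by (simp add: m_def S_def)
  have "m > 0" unfolding m_def by (rule N_pos)
  \<comment> \<open>At this radius \<open>s * N z0\<close> is 1/2, so the element \<open>e\<close>
    below has seminorm at most 1/2 and its powers decay geometrically.\<close>
  define s where "s = 1 / (2 * m)"
  have s: "s > 0" "s * m = 1 / 2" using \<open>m > 0\<close> by (auto simp: s_def)
  define \<delta> where "\<delta> = m - N (z0 + of_real s)"
  have "\<delta> > 0"
  proof -
    have "z0 + of_real s \<notin> S"
    proof
      assume "z0 + of_real s \<in> S"
      with z0(2) have "Re (z0 + of_real s) \<le> Re z0" by blast
      then show False using s(1) by simp
    qed
    then show ?thesis using m[of "z0 + of_real s"] z0(1) by (auto simp: \<delta>_def S_def m_def)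
  qed
  define e where "e = of_real s *\<^sub>C r z0"
  have eI: "e \<in> idealizer" unfolding e_def by (intro idealizer_scaleC rI)
  have e_half: "dist_mod e \<le> 1 / 2"
    using dist_mod_scaleC_le[of "of_real s" "r z0"] s by (simp add: e_def m_def N_def)
  have key: "\<delta> \<le> m * (of_nat n * (1 / 2) ^ n)" if n: "n > 0" for n :: nat
  proof -
    define \<omega> where "\<omega> = exp (2 * of_real pi * \<i> / of_nat n :: complex)"
    have \<omega>j: "\<omega> ^ j = exp (2 * of_real pi * \<i> * of_nat j / of_nat n)" for j
      by (simp add: \<omega>_def mult_ac flip: exp_of_nat_mult)
    have \<omega>n: "\<omega> ^ n = 1" using \<omega>j[of n] n by simp
    define p where "p k = z0 + of_real s * \<omega> ^ k" for k
    \<comment> \<open>Modulo \<open>M\<close>, r (p k) (1 - u) is r z0 for the element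
      \<open>u\<close> below. Multiplying by the geometric sum replaces 1 - u by 1 - u^n, and u^n =
      e^n no longer depends on \<open>k\<close>.\<close>
    have vertex: "r (p k) * (1 - e ^ n) - r z0 * (\<Sum>j<n. (\<omega> ^ k) ^ j *\<^sub>C e ^ j) \<in> M" for k
    proof -
      define u where "u = \<omega> ^ k *\<^sub>C e"
      have uI: "u \<in> idealizer" unfolding u_def by (intro idealizer_scaleC eI)
      have "(\<omega> ^ k) ^ n = 1" by (metis \<omega>n mult.commute power_mult power_one)
      then have un: "u ^ n = e ^ n" by (simp add: u_def scaleC_power)
      have a: "(r (p k) * (c - p k *\<^sub>C 1) - 1) * r z0 \<in> M" by (rule idealizer_mem_mult[OF rl rI])
      have b: "r (p k) * ((c - z0 *\<^sub>C 1) * r z0 - 1) \<in> M" by (rule mult_mem[OF rr])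
      have "(r (p k) * (c - p k *\<^sub>C 1) - 1) * r z0 - r (p k) * ((c - z0 *\<^sub>C 1) * r z0 - 1)
          = r (p k) * (1 - u) - r z0"
        by (simp add: p_def u_def e_def algebra_simps scaleC.scale_left_distrib)
      then have "r (p k) * (1 - u) - r z0 \<in> M" using diff_mem[OF a b] by simp
      then have "(r (p k) * (1 - u) - r z0) * (\<Sum>j<n. u ^ j) \<in> M"
        by (intro idealizer_mem_mult idealizer_sum idealizer_power uI)
      moreover have usum: "(\<Sum>j<n. u ^ j) = (\<Sum>j<n. (\<omega> ^ k) ^ j *\<^sub>C e ^ j)"
        by (simp add: u_def scaleC_power)
      have "(1 - u) * (\<Sum>j<n. (\<omega> ^ k) ^ j *\<^sub>C e ^ j) = 1 - e ^ n"
        using geometric_identity[of u n] by (simp only: usum un)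
      then have "(r (p k) * (1 - u) - r z0) * (\<Sum>j<n. u ^ j)
          = r (p k) * (1 - e ^ n) - r z0 * (\<Sum>j<n. (\<omega> ^ k) ^ j *\<^sub>C e ^ j)"
        by (simp only: left_diff_distrib[of "r (p k) * (1 - u)"] mult.assoc usum)
      ultimately show ?thesis by simp
    qed
    define Y where "Y = (1 / of_nat n) *\<^sub>C (\<Sum>k<n. r (p k))"
    have dY: "dist_mod Y \<le> m - \<delta> / n"
    proof -
      have "(\<Sum>k<n. N (p k)) = N (p 0) + (\<Sum>k\<in>{..<n} - {0}. N (p k))"
        using n by (intro sum.remove) auto
      also have "\<dots> \<le> (m - \<delta>) + (\<Sum>k\<in>{..<n} - {0}. m)"
        by (intro add_mono sum_mono m) (simp add: p_def \<delta>_def)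
      also have "\<dots> = n * m - \<delta>"
        using n by (simp add: card_Diff_singleton of_nat_diff algebra_simps)
      finally have *: "(\<Sum>k<n. N (p k)) \<le> n * m - \<delta>" .
      have "dist_mod Y \<le> cmod (1 / of_nat n) * dist_mod (\<Sum>k<n. r (p k))"
        unfolding Y_def by (rule dist_mod_scaleC_le)
      also have "\<dots> \<le> (1 / n) * (\<Sum>k<n. N (p k))"
        unfolding N_def using dist_mod_sum[of "\<lambda>k. r (p k)" "{..<n}"]
        by (simp add: norm_divide divide_right_mono)
      also have "\<dots> \<le> (1 / n) * (n * m - \<delta>)" by (intro mult_left_mono *) simp
      also have "\<dots> = m - \<delta> / n" using n by (simp add: field_simps)
      finally show ?thesis .
    qed
    \<comment> \<open>Averaging over \<open>k\<close> annihilates every power e^j with 0 < j < n,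
      and only the central value remains.\<close>
    have "Y * (1 - e ^ n) - r z0 \<in> M"
    proof -
      have "(1 / of_nat n) *\<^sub>C (\<Sum>k<n. r (p k) * (1 - e ^ n) - r z0 * (\<Sum>j<n. (\<omega> ^ k) ^ j *\<^sub>C e ^ j)) \<in> M"
        by (intro scaleC_mem sum_mem vertex)
      moreover have "(\<Sum>k<n. r z0 * (\<Sum>j<n. (\<omega> ^ k) ^ j *\<^sub>C e ^ j)) = of_nat n *\<^sub>C r z0"
      proof -
        have "(\<Sum>k<n. \<Sum>j<n. (\<omega> ^ k) ^ j *\<^sub>C e ^ j) = (\<Sum>j<n. (\<Sum>k<n. (\<omega> ^ j) ^ k) *\<^sub>C e ^ j)"
          by (subst sum.swap) (simp add: scaleC.scale_sum_left mult.commute flip: power_mult)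
        also have "\<dots> = (\<Sum>j<n. if j = 0 then of_nat n *\<^sub>C 1 else 0)"
          using sum_powers_root_of_unity by (intro sum.cong refl) (simp add: \<omega>j)
        also have "\<dots> = of_nat n *\<^sub>C 1" using n by (simp add: sum.delta)
        finally show ?thesis by (simp flip: sum_distrib_left)
      qed
      ultimately show ?thesis using n
        by (simp add: Y_def sum_subtractf scaleC.scale_right_diff_distrib flip: sum_distrib_right)
    qed
    then have "m = dist_mod (Y * (1 - e ^ n))" unfolding m_def N_def by (rule dist_mod_cong[symmetric])
    also have "\<dots> \<le> dist_mod Y + dist_mod (- (Y * e ^ n))"
      using dist_mod_triangle[of Y "- (Y * e ^ n)"] by (simp add: algebra_simps)
    also have "\<dots> \<le> dist_mod Y + dist_mod Y * (1 / 2) ^ n"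
    proof (intro add_left_mono order_trans[OF dist_mod_uminus] order_trans[OF dist_mod_mult_le] mult_left_mono)
      show "dist_mod (e ^ n) \<le> (1 / 2) ^ n"
        using dist_mod_power_le[OF eI n] power_mono[OF e_half dist_mod_nonneg, of n] by simp
    qed (auto intro: idealizer_power eI dist_mod_nonneg)
    also have "\<dots> \<le> (m - \<delta> / n) + m * (1 / 2) ^ n"
      using dY \<open>\<delta> > 0\<close> n by (intro add_mono mult_right_mono) (auto intro: order_trans)
    finally show ?thesis using n by (simp add: field_simps)
  qed
  have "(\<lambda>n. m * (of_nat n * (1 / 2 :: real) ^ n)) \<longlonglongrightarrow> m * 0"
    by (intro tendsto_mult_left powser_times_n_limit_0) simp
  then have "\<forall>\<^sub>F n in sequentially. m * (of_nat n * (1 / 2 :: real) ^ n) < \<delta>"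
    by (rule order_tendstoD) (use \<open>\<delta> > 0\<close> in simp)
  then have "\<forall>\<^sub>F n in sequentially. m * (of_nat n * (1 / 2 :: real) ^ n) < \<delta> \<and> n > 0"
    using eventually_gt_at_top[of 0] by (rule eventually_conj)
  then obtain n where "m * (of_nat n * (1 / 2 :: real) ^ n) < \<delta>" "n > 0"
    using eventually_happens'[OF sequentially_bot] by blast
  then show False using key[of n] by simp
qed

text \<open>The dual form of the Jacobson density theorem for \<open>A / M\<close>.\<close>

theorem density_mod:
  assumes "finite S" "\<And>x. (\<And>v. v \<in> S \<Longrightarrow> x * v \<in> M) \<Longrightarrow> x * w \<in> M"
  shows "\<exists>c. w - (\<Sum>v\<in>S. c v *\<^sub>C v) \<in> M"
  using assms
proof (induction S arbitrary: w rule: finite_induct)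
  case empty
  show ?case using empty[of 1] by simp
next
  case (insert v S)
  show ?case
  proof (cases "\<forall>x. (\<forall>u\<in>S. x * u \<in> M) \<longrightarrow> x * v \<in> M")
    case True
    then have "\<exists>c. w - (\<Sum>u\<in>S. c u *\<^sub>C u) \<in> M"
      by (intro insert.IH insert.prems) auto
    then obtain c where "w - (\<Sum>u\<in>S. c u *\<^sub>C u) \<in> M" ..
    moreover have "(\<Sum>u\<in>insert v S. (c(v := 0)) u *\<^sub>C u) = (\<Sum>u\<in>S. c u *\<^sub>C u)"
      using insert.hyps by (auto intro!: sum.cong)
    ultimately show ?thesis by metis
  next
    case False
    then obtain l0 where l0: "\<forall>u\<in>S. l0 * u \<in> M" "l0 * v \<notin> M" by blast
    obtain y where y: "y * (l0 * v) - 1 \<in> M" by (rule left_inverse_mod[OF l0(2)])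
    define l where "l = y * l0"
    have lS: "l * u \<in> M" if "u \<in> S" for u
      using mult_mem[of "l0 * u" y] l0(1) that by (simp add: l_def mult.assoc)
    have lv: "l * v - 1 \<in> M" using y by (simp add: l_def mult.assoc)
    \<comment> \<open>For m in \<open>M\<close>, the product m l sends \<open>v\<close> and all of
      \<open>S\<close> into \<open>M\<close>, hence also \<open>w\<close> by hypothesis. The scalar
      \<open>z\<close> that \<open>l * w\<close> then represents is the coefficient of
      \<open>v\<close>.\<close>
    have "l * w \<in> idealizer" unfolding idealizer_def
    proof (intro CollectI ballI)
      fix m assume m: "m \<in> M"
      have "m * (l * v - 1) \<in> M" by (rule mult_mem[OF lv])
      then have *: "(m * l) * v - m \<in> M" by (simp add: algebra_simps)
      then have "(m * l) * v \<in> M" using m mem_cong[OF *] by simp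
      moreover have "(m * l) * u \<in> M" if "u \<in> S" for u
        using mult_mem[OF lS[OF that], of m] by (simp add: mult.assoc)
      ultimately have "(m * l) * w \<in> M" by (intro insert.prems) auto
      then show "m * (l * w) \<in> M" by (simp add: mult.assoc)
    qed
    then obtain z where z: "l * w - z *\<^sub>C 1 \<in> M" by (rule idealizer_scalar_mod)
    have "\<exists>c. (w - z *\<^sub>C v) - (\<Sum>u\<in>S. c u *\<^sub>C u) \<in> M"
    proof (rule insert.IH)
      fix x assume x: "\<And>u. u \<in> S \<Longrightarrow> x * u \<in> M"
      \<comment> \<open>The correction makes \<open>x\<close> annihilate \<open>v\<close> modulo
        \<open>M\<close> without disturbing \<open>S\<close>; hence it annihilates \<open>w\<close>,
        which is the claim for w - z v.\<close>
      let ?x = "x - x * v * l"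
      have "?x * u \<in> M" if "u \<in> S" for u
        using diff_mem[OF x[OF that] mult_mem[OF lS[OF that], of "x * v"]] by (simp add: algebra_simps)
      moreover have "?x * v \<in> M"
        using uminus_mem[OF mult_mem[OF lv, of "x * v"]] by (simp add: algebra_simps)
      ultimately have "?x * w \<in> M" by (intro insert.prems) auto
      moreover have "x * v * (l * w - z *\<^sub>C 1) \<in> M" by (rule mult_mem[OF z])
      ultimately have "?x * w + x * v * (l * w - z *\<^sub>C 1) \<in> M" by (rule add_mem)
      then show "x * (w - z *\<^sub>C v) \<in> M" by (simp add: algebra_simps)
    qed
    then obtain c where c: "(w - z *\<^sub>C v) - (\<Sum>u\<in>S. c u *\<^sub>C u) \<in> M" ..
    have "(\<Sum>u\<in>insert v S. (c(v := z)) u *\<^sub>C u) = z *\<^sub>C v + (\<Sum>u\<in>S. c u *\<^sub>C u)"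
      using insert.hyps by (auto intro!: sum.cong)
    then have "w - (\<Sum>u\<in>insert v S. (c(v := z)) u *\<^sub>C u) \<in> M"
      using c by (simp add: algebra_simps)
    then show ?thesis by blast
  qed
qed

end

subsection \<open>Minimal idempotents\<close>

lemma ecard_ge:
  assumes "finite B" "B \<subseteq> K"
  shows "enat (card B) \<le> ecard K"
  using assms card_mono by (auto simp: ecard_def)

lemma ecard_nonzero_spectrum_le_rank: "ecard (nonzero_spectrum (x * a)) \<le> elem_rank a"
  unfolding elem_rank_def by (rule SUP_upper) simp

lemma two_sided_idealD:
  assumes "two_sided_ideal J"
  shows "0 \<in> J" "x \<in> J \<Longrightarrow> y \<in> J \<Longrightarrow> x + y \<in> J" "x \<in> J \<Longrightarrow> a * x \<in> J"
    "x \<in> J \<Longrightarrow> x * a \<in> J" "x \<in> J \<Longrightarrow> - x \<in> J" "x \<in> J \<Longrightarrow> y \<in> J \<Longrightarrow> x - y \<in> J"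
proof -
  have J: "left_ideal J" using assms by (simp add: two_sided_ideal_def)
  show "0 \<in> J" "x \<in> J \<Longrightarrow> y \<in> J \<Longrightarrow> x + y \<in> J" "x \<in> J \<Longrightarrow> a * x \<in> J"
    "x \<in> J \<Longrightarrow> - x \<in> J" "x \<in> J \<Longrightarrow> y \<in> J \<Longrightarrow> x - y \<in> J"
    by (rule left_idealD[OF J]; assumption)+
  show "x \<in> J \<Longrightarrow> x * a \<in> J" using assms by (simp add: two_sided_ideal_def)
qed

section \<open>Finite rank on the irreducible module\<close>

context max_left_ideal
begin

text \<open>Biorthogonality of the \<open>x i\<close> with the \<open>a * v j\<close> modulo
  \<open>M\<close>: a certificate that left multiplication by \<open>a\<close> on A / M has rank at
  least k.\<close>

definition dual_family :: "'a \<Rightarrow> nat \<Rightarrow> (nat \<Rightarrow> 'a) \<Rightarrow> (nat \<Rightarrow> 'a) \<Rightarrow> bool" where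
  "dual_family a k v x \<longleftrightarrow> (\<forall>i<k. \<forall>j<k. x i * (a * v j) - (if i = j then 1 else 0) \<in> M)"

lemma dual_familyD:
  assumes "dual_family a k v x" "i < k" "j < k"
  shows "i = j \<Longrightarrow> x i * (a * v j) - 1 \<in> M" "i \<noteq> j \<Longrightarrow> x i * (a * v j) \<in> M"
  using assms unfolding dual_family_def by fastforce+

text \<open>Summing the elements (i + 1) v_i x_i gives \<open>y\<close> for which each
  \<open>v j\<close> is an eigenvector of \<open>y * a\<close> modulo \<open>M\<close> with
  eigenvalue j + 1. These k values are distinct and nonzero.\<close>

lemma dual_family_le_rank:
  assumes d: "dual_family a k v x"
  shows "enat k \<le> elem_rank a"
proof -
  define y where "y = (\<Sum>i<k. of_nat (i + 1) *\<^sub>C (v i * x i))"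
  have "of_nat (j + 1) \<in> nonzero_spectrum (y * a)" if j: "j < k" for j
  proof -
    have "v i * (x i * (a * v j)) - (if i = j then v j else 0) \<in> M" if "i < k" for i
      using mult_mem[of "x i * (a * v j) - (if i = j then 1 else 0)" "v i"] d that j
      unfolding dual_family_def by (auto simp: algebra_simps split: if_splits)
    then have "(\<Sum>i<k. of_nat (i + 1) *\<^sub>C (v i * (x i * (a * v j)) - (if i = j then v j else 0))) \<in> M"
      by (intro sum_mem scaleC_mem) auto
    moreover have "(\<Sum>i<k. of_nat (i + 1) *\<^sub>C (if i = j then v j else 0)) =
        (\<Sum>i<k. if i = j then of_nat (j + 1) *\<^sub>C v j else 0)"
      by (intro sum.cong) auto
    moreover have "(\<Sum>i<k. of_nat (i + 1) *\<^sub>C (v i * (x i * (a * v j)))) = y * a * v j"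
      by (simp add: y_def sum_distrib_right mult.assoc)
    ultimately have ev: "y * a * v j - of_nat (j + 1) *\<^sub>C v j \<in> M"
      using j by (simp add: scaleC.scale_right_diff_distrib sum_subtractf sum.delta)
    have "of_nat (j + 1) \<in> spectrum (y * a)"
    proof (rule ccontr)
      assume "of_nat (j + 1) \<notin> spectrum (y * a)"
      then obtain u where u: "u * (of_nat (j + 1) *\<^sub>C 1 - y * a) = 1"
        unfolding spectrum_def by auto
      have "v j = u * (of_nat (j + 1) *\<^sub>C 1 - y * a) * v j" by (simp only: u mult_1_left)
      also have "\<dots> = - u * (y * a * v j - of_nat (j + 1) *\<^sub>C v j)"
        by (simp add: algebra_simps)
      also have "\<dots> \<in> M" by (rule mult_mem[OF ev])
      finally have "x j * (a * v j) \<in> M" by (intro mult_mem)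
      then show False using mem_cong[OF dual_familyD(1)[OF d j j]] one_not_mem by simp
    qed
    moreover have "of_nat (j + 1) \<noteq> (0 :: complex)" using of_nat_neq_0[of j] by simp
    ultimately show ?thesis by (simp add: nonzero_spectrum_def)
  qed
  then have "enat (card ((\<lambda>j. of_nat (j + 1) :: complex) ` {..<k})) \<le> ecard (nonzero_spectrum (y * a))"
    by (intro ecard_ge) auto
  moreover have "card ((\<lambda>j. of_nat (j + 1) :: complex) ` {..<k}) = k"
    by (subst card_image) (auto simp: inj_on_def)
  ultimately show ?thesis using ecard_nonzero_spectrum_le_rank[of y a] by simp
qed

text \<open>A Gram-Schmidt step: a left multiple \<open>u\<close> of \<open>z\<close> takes the
  value 1 on a w modulo \<open>M\<close>, and each old \<open>x i\<close> is corrected by a left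
  multiple of \<open>u\<close> so as to vanish there.\<close>

lemma dual_family_extend:
  assumes d: "dual_family a k v x" and z: "\<And>j. j < k \<Longrightarrow> z * (a * v j) \<in> M" "z * (a * w) \<notin> M"
  obtains v' x' where "dual_family a (Suc k) v' x'"
proof -
  obtain y where y: "y * (z * (a * w)) - 1 \<in> M" by (rule left_inverse_mod[OF z(2)])
  define u where "u = y * z"
  have uw: "u * (a * w) - 1 \<in> M" using y by (simp add: u_def mult.assoc)
  have uv: "u * (a * v j) \<in> M" if "j < k" for j
    using mult_mem[OF z(1)[OF that], of y] by (simp add: u_def mult.assoc)
  define v' where "v' = v(k := w)"
  define x' where "x' = (\<lambda>i. if i < k then x i - x i * (a * w) * u else u)"
  have "dual_family a (Suc k) v' x'" unfolding dual_family_def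
  proof (intro allI impI)
    fix i j assume ij: "i < Suc k" "j < Suc k"
    consider "i < k" "j < k" | "i < k" "j = k" | "i = k" "j < k" | "i = k" "j = k"
      using ij by linarith
    then show "x' i * (a * v' j) - (if i = j then 1 else 0) \<in> M"
    proof cases
      case 1
      then have "x i * (a * v j) - (if i = j then 1 else 0) \<in> M"
        using d by (auto simp: dual_family_def)
      moreover have "x i * (a * w) * (u * (a * v j)) \<in> M" by (intro mult_mem uv 1)
      ultimately have "(x i * (a * v j) - (if i = j then 1 else 0)) - x i * (a * w) * (u * (a * v j)) \<in> M"
        by (rule diff_mem)
      moreover have "x' i * (a * v' j) - (if i = j then 1 else 0) =
          (x i * (a * v j) - (if i = j then 1 else 0)) - x i * (a * w) * (u * (a * v j))"
        using 1 by (simp add: x'_def v'_def algebra_simps)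
      ultimately show ?thesis by (simp only:)
    next
      case 2
      then have "x' i * (a * v' j) - (if i = j then 1 else 0) = - (x i * (a * w) * (u * (a * w) - 1))"
        by (simp add: x'_def v'_def algebra_simps)
      then show ?thesis using uminus_mem[OF mult_mem[OF uw]] by (simp only:)
    next
      case 3
      then show ?thesis using uv by (simp add: x'_def v'_def)
    next
      case 4
      then show ?thesis using uw by (simp add: x'_def v'_def)
    qed
  qed
  then show thesis by (rule that)
qed

text \<open>Finite spectral rank bounds k, so a family of maximal length exists. As it cannot be
  extended, whatever annihilates all \<open>a * v j\<close> modulo \<open>M\<close> annihilates
  every \<open>a * w\<close>, and density puts \<open>a * w\<close> in their span.\<close>

lemma maximal_dual_family:
  assumes "elem_rank a \<noteq> \<infinity>"
  obtains k v x where "dual_family a k v x"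
    "\<And>w. \<exists>c. a * w - (\<Sum>j<k. c j *\<^sub>C (a * v j)) \<in> M"
proof -
  obtain n where n: "elem_rank a = enat n" using assms by auto
  let ?P = "\<lambda>k. \<exists>v x. dual_family a k v x"
  have "?P 0" by (simp add: dual_family_def)
  moreover have bound: "k \<le> n" if "?P k" for k using that dual_family_le_rank n by fastforce
  ultimately have P: "?P (Greatest ?P)" by (rule GreatestI_nat)
  define k where "k = Greatest ?P"
  obtain v x where d: "dual_family a k v x" using P k_def by blast
  have max: "\<not> ?P (Suc k)"
    using Greatest_le_nat[of ?P "Suc k" n] bound by (auto simp: k_def)
  \<comment> \<open>\<open>density_mod\<close> takes sums over a set of vectors; injectivity
    converts them to sums over indices.\<close>
  have inj: "inj_on (\<lambda>j. a * v j) {..<k}"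
  proof (rule inj_onI, rule ccontr)
    fix i j assume ij: "i \<in> {..<k}" "j \<in> {..<k}" "a * v i = a * v j" "i \<noteq> j"
    then have "x i * (a * v i) \<in> M" using dual_familyD(2)[OF d, of i j] by simp
    then show False using ij mem_cong[OF dual_familyD(1)[OF d, of i i]] one_not_mem by simp
  qed
  have "\<exists>c. a * w - (\<Sum>j<k. c j *\<^sub>C (a * v j)) \<in> M" for w
  proof -
    have "\<exists>c. a * w - (\<Sum>y\<in>(\<lambda>j. a * v j) ` {..<k}. c y *\<^sub>C y) \<in> M"
    proof (rule density_mod)
      fix z assume z: "\<And>y. y \<in> (\<lambda>j. a * v j) ` {..<k} \<Longrightarrow> z * y \<in> M"
      show "z * (a * w) \<in> M"
      proof (rule ccontr)
        assume "z * (a * w) \<notin> M"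
        then obtain v' x' where "dual_family a (Suc k) v' x'"
          by (rule dual_family_extend[OF d, rotated]) (use z in auto)
        then show False using max by blast
      qed
    qed simp
    then obtain c where "a * w - (\<Sum>y\<in>(\<lambda>j. a * v j) ` {..<k}. c y *\<^sub>C y) \<in> M" ..
    then have "a * w - (\<Sum>j<k. c (a * v j) *\<^sub>C (a * v j)) \<in> M"
      by (simp add: sum.reindex[OF inj])
    then show ?thesis by (intro exI[of _ "\<lambda>j. c (a * v j)"])
  qed
  with d show thesis by (rule that)
qed

text \<open>The socle elements that act as zero on A / M form a two-sided ideal. It omits
  \<open>a\<close>, as the choice w = 1 shows, so minimality leaves only zero.\<close>

lemma socle_faithful:
  fixes a b :: 'a
  assumes "minimal_two_sided_ideal (Soc :: 'a set)" "a \<in> Soc" "a \<notin> M"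
    and "b \<in> Soc" "\<And>w. b * w \<in> M"
  shows "b = 0"
proof -
  have S: "two_sided_ideal (Soc :: 'a set)" using assms(1) by (simp add: minimal_two_sided_ideal_def)
  define P where "P = {b \<in> Soc. \<forall>w. b * w \<in> M}"
  have "two_sided_ideal P"
    unfolding two_sided_ideal_def left_ideal_def P_def
    by (auto simp: two_sided_idealD[OF S] zero_mem distrib_right add_mem mult.assoc mult_mem)
  moreover have "P \<subseteq> Soc" by (auto simp: P_def)
  moreover have "P \<noteq> Soc" using assms(2,3) unfolding P_def
    by (metis (mono_tags, lifting) mem_Collect_eq mult.right_neutral)
  ultimately have "P = {0}" using assms(1) by (auto simp: minimal_two_sided_ideal_def)
  moreover have "b \<in> P" using assms by (auto simp: P_def)
  ultimately show ?thesis by simp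
qed

end

theorem minimal_idempotent_exists:
  assumes ss: "semisimple TYPE('a::complex_banach_algebra_1)"
    and min: "minimal_two_sided_ideal (Soc :: 'a::complex_banach_algebra_1 set)"
    and "(Soc :: 'a::complex_banach_algebra_1 set) \<noteq> {0}"
  obtains e :: "'a::complex_banach_algebra_1" and \<phi>
  where "e \<in> Soc" "e \<noteq> 0" "e * e = e" "\<And>z. e * z * e = \<phi> z *\<^sub>C e"
proof -
  have S: "two_sided_ideal (Soc :: 'a set)" using min by (simp add: minimal_two_sided_ideal_def)
  obtain a :: 'a where a: "a \<in> Soc" "a \<noteq> 0"
    using assms(3) two_sided_idealD(1)[OF S] by auto
  then have "a \<notin> jacobson_radical" using ss by (auto simp: semisimple_def)
  then obtain M where M: "maximal_left_ideal M" "a \<notin> M" unfolding jacobson_radical_def by auto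
  interpret max_left_ideal M by standard (rule M(1))
  have "elem_rank a \<noteq> \<infinity>" using a(1) by (simp add: Soc_def)
  then obtain k v x where d: "dual_family a k v x"
    and span: "\<And>w. \<exists>c. a * w - (\<Sum>j<k. c j *\<^sub>C (a * v j)) \<in> M"
    by (rule maximal_dual_family) blast
  have k: "k > 0"
  proof (rule ccontr)
    assume "\<not> k > 0"
    then have "a \<in> M" using span[of 1] by simp
    then show False using M(2) by simp
  qed
  \<comment> \<open>On A / M this is the rank-one projection of the first dual pair: its range lies
    in the line of \<open>v 0\<close>, and it fixes \<open>v 0\<close>. The value \<phi>(z) will be
    the coefficient of e z v_0 on \<open>v 0\<close>; the identities for \<open>e\<close> are
    checked on A / M and lifted by \<open>socle_faithful\<close>.\<close>
  define e where "e = v 0 * x 0 * a"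
  have eS: "e \<in> Soc" unfolding e_def by (rule two_sided_idealD(3)[OF S a(1)])
  have "\<exists>t. e * w - t *\<^sub>C v 0 \<in> M" for w
  proof -
    obtain c where c: "a * w - (\<Sum>j<k. c j *\<^sub>C (a * v j)) \<in> M" using span by blast
    have "x 0 * (a * v j) - (if j = 0 then 1 else 0) \<in> M" if "j < k" for j
      using dual_familyD[OF d k that] by auto
    then have "(\<Sum>j<k. c j *\<^sub>C (x 0 * (a * v j) - (if j = 0 then 1 else 0))) \<in> M"
      by (intro sum_mem scaleC_mem) auto
    moreover have "(\<Sum>j<k. c j *\<^sub>C (if j = 0 then 1 else 0 :: 'a)) = (\<Sum>j<k. if j = 0 then c 0 *\<^sub>C 1 else 0)"
      by (intro sum.cong) auto
    ultimately have "x 0 * (\<Sum>j<k. c j *\<^sub>C (a * v j)) - c 0 *\<^sub>C 1 \<in> M"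
      using k by (simp add: scaleC.scale_right_diff_distrib sum_subtractf sum.delta sum_distrib_left)
    with mult_mem[OF c, of "x 0"]
    have "x 0 * (a * w - (\<Sum>j<k. c j *\<^sub>C (a * v j))) + (x 0 * (\<Sum>j<k. c j *\<^sub>C (a * v j)) - c 0 *\<^sub>C 1) \<in> M"
      by (rule add_mem)
    then have "x 0 * (a * w) - c 0 *\<^sub>C 1 \<in> M" by (simp add: right_diff_distrib)
    from mult_mem[OF this, of "v 0"] have "e * w - c 0 *\<^sub>C v 0 \<in> M"
      by (simp add: e_def algebra_simps)
    then show ?thesis by blast
  qed
  then obtain t where t: "\<And>w. e * w - t w *\<^sub>C v 0 \<in> M" by metis
  have ev: "e * v 0 - v 0 \<in> M"
    using mult_mem[OF dual_familyD(1)[OF d k k refl], of "v 0"] by (simp add: e_def algebra_simps)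
  have ze: "z * (e * w) - t w *\<^sub>C (z * v 0) \<in> M" for z w
    using mult_mem[OF t, of z w] by (simp add: algebra_simps)
  have "e * e - e = 0"
  proof (rule socle_faithful[OF min a(1) M(2)])
    show "e * e - e \<in> Soc" by (intro two_sided_idealD[OF S] eS)
    fix w
    have "e * (e * w) - t w *\<^sub>C (e * v 0) \<in> M" by (rule ze)
    moreover have "t w *\<^sub>C (e * v 0 - v 0) \<in> M" by (rule scaleC_mem[OF ev])
    ultimately have "(e * (e * w) - t w *\<^sub>C (e * v 0)) + t w *\<^sub>C (e * v 0 - v 0) \<in> M" by (rule add_mem)
    from diff_mem[OF this t[of w]] show "(e * e - e) * w \<in> M"
      by (simp add: algebra_simps)
  qed
  moreover have "e * z * e - t (z * v 0) *\<^sub>C e = 0" for z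
  proof (rule socle_faithful[OF min a(1) M(2)])
    have "t (z * v 0) *\<^sub>C e = (t (z * v 0) *\<^sub>C 1) * e" by simp
    also have "\<dots> \<in> Soc" by (rule two_sided_idealD(3)[OF S eS])
    finally show "e * z * e - t (z * v 0) *\<^sub>C e \<in> Soc"
      by (intro two_sided_idealD(6)[OF S] two_sided_idealD(3)[OF S] eS)
    fix w
    have "e * z * (e * w) - t w *\<^sub>C (e * z * v 0) \<in> M" by (rule ze)
    moreover have "t w *\<^sub>C (e * (z * v 0) - t (z * v 0) *\<^sub>C v 0) \<in> M" by (intro scaleC_mem t)
    ultimately have "(e * z * (e * w) - t w *\<^sub>C (e * z * v 0)) + t w *\<^sub>C (e * (z * v 0) - t (z * v 0) *\<^sub>C v 0) \<in> M"
      by (rule add_mem)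
    moreover have "t (z * v 0) *\<^sub>C (e * w - t w *\<^sub>C v 0) \<in> M" by (intro scaleC_mem t)
    ultimately have "((e * z * (e * w) - t w *\<^sub>C (e * z * v 0)) + t w *\<^sub>C (e * (z * v 0) - t (z * v 0) *\<^sub>C v 0))
      - t (z * v 0) *\<^sub>C (e * w - t w *\<^sub>C v 0) \<in> M" by (rule diff_mem)
    then show "(e * z * e - t (z * v 0) *\<^sub>C e) * w \<in> M"
      by (simp add: algebra_simps)
  qed
  moreover have "e \<noteq> 0"
  proof
    assume "e = 0"
    then have "v 0 \<in> M" using uminus_mem[OF ev] by simp
    then have "x 0 * (a * v 0) \<in> M" by (intro mult_mem)
    then show False using mem_cong[OF dual_familyD(1)[OF d k k refl]] one_not_mem by simp
  qed
  ultimately show thesis using eS by (intro that[of e "\<lambda>z. t (z * v 0)"]) simp_all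
qed

section \<open>Dual vectors for independent linear functionals\<close>

lemma linear_functional_onD:
  assumes "linear_functional_on UNIV g"
  shows "g (x + y) = g x + g y" "g (c *\<^sub>C x) = c * g x" "g 0 = 0" "g (x - y) = g x - g y"
proof -
  show *: "g (x + y) = g x + g y" "g (c *\<^sub>C x) = c * g x" for x y c
    using assms by (auto simp: linear_functional_on_def)
  show "g 0 = 0" using *(2)[of 0 0] by simp
  show "g (x - y) = g x - g y" using *(1)[of x "(-1) *\<^sub>C y"] *(2)[of "-1" y] by simp
qed

text \<open>A vector \<open>l\<close> killed by \<open>S\<close> but not by \<open>g k\<close>
  determines the coefficient of \<open>g k\<close>; a common zero of \<open>S\<close> becomes one of
  all the \<open>g i\<close> after subtracting a multiple of \<open>l\<close>.\<close>

lemma functional_in_span: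
  assumes "finite S" "\<And>i. i \<in> S \<Longrightarrow> linear_functional_on UNIV (g i)"
    and "linear_functional_on UNIV h" "\<And>z. (\<And>i. i \<in> S \<Longrightarrow> g i z = 0) \<Longrightarrow> h z = 0"
  shows "\<exists>c. \<forall>z. h z = (\<Sum>i\<in>S. c i * g i z)"
  using assms
proof (induction S arbitrary: h rule: finite_induct)
  case (insert k S)
  have lin: "linear_functional_on UNIV (g i)" if "i \<in> S" for i using insert.prems(1) that by simp
  note gk = linear_functional_onD[OF insert.prems(1)[of k, simplified]]
  note hl = linear_functional_onD[OF insert.prems(2)]
  show ?case
  proof (cases "\<forall>z. (\<forall>i\<in>S. g i z = 0) \<longrightarrow> g k z = 0")
    case True
    have "\<exists>c. \<forall>z. h z = (\<Sum>i\<in>S. c i * g i z)"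
      by (rule insert.IH[OF lin insert.prems(2)]) (use True insert.prems(3) in auto)
    then obtain c where c: "\<And>z. h z = (\<Sum>i\<in>S. c i * g i z)" by blast
    have "h z = (\<Sum>i\<in>insert k S. (c(k := 0)) i * g i z)" for z
      using insert.hyps by (auto simp: c intro!: sum.cong)
    then show ?thesis by blast
  next
    case False
    then obtain l where l: "\<And>i. i \<in> S \<Longrightarrow> g i l = 0" "g k l \<noteq> 0" by blast
    define t where "t = h l / g k l"
    define h' where "h' = (\<lambda>z. h z - t * g k z)"
    have "\<exists>c. \<forall>z. h' z = (\<Sum>i\<in>S. c i * g i z)"
    proof (rule insert.IH)
      show "linear_functional_on UNIV (g i)" if "i \<in> S" for i using that by (rule lin)
      show "linear_functional_on UNIV h'"
        unfolding linear_functional_on_def h'_def by (auto simp: gk hl algebra_simps)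
      fix z assume z: "\<And>i. i \<in> S \<Longrightarrow> g i z = 0"
      have "h (z - (g k z / g k l) *\<^sub>C l) = 0"
      proof (rule insert.prems(3))
        fix i assume "i \<in> insert k S"
        then show "g i (z - (g k z / g k l) *\<^sub>C l) = 0"
          using l z linear_functional_onD[OF lin, of i] by (auto simp: gk)
      qed
      then show "h' z = 0" using l(2) by (simp add: hl h'_def t_def)
    qed
    then obtain c where c: "\<And>z. h' z = (\<Sum>i\<in>S. c i * g i z)" by blast
    have "h z = (\<Sum>i\<in>insert k S. (c(k := t)) i * g i z)" for z
    proof -
      have "(\<Sum>i\<in>S. (c(k := t)) i * g i z) = (\<Sum>i\<in>S. c i * g i z)"
        using insert.hyps by (intro sum.cong) auto
      then show ?thesis using insert.hyps c[of z] by (simp add: h'_def algebra_simps)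
    qed
    then show ?thesis by blast
  qed
qed simp

text \<open>If \<open>g k\<close> vanished on the common kernel of the others, it would be a
  combination of them, against independence. A vector of that kernel outside the kernel of
  \<open>g k\<close> only needs rescaling.\<close>

lemma dual_vectors_exist:
  fixes n :: nat
  assumes lin: "\<And>i. i < n \<Longrightarrow> linear_functional_on UNIV (g i)"
    and ind: "\<And>c i. (\<And>z. (\<Sum>i<n. c i * g i z) = 0) \<Longrightarrow> i < n \<Longrightarrow> c i = 0"
  obtains v where "\<And>i k. i < n \<Longrightarrow> k < n \<Longrightarrow> g i (v k) = (if i = k then 1 else (0::complex))"
proof -
  have "\<exists>v. \<forall>i<n. g i v = (if i = k then 1 else 0)" if k: "k < n" for k
  proof -
    have "\<exists>z. (\<forall>i\<in>{..<n} - {k}. g i z = 0) \<and> g k z \<noteq> 0"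
    proof (rule ccontr)
      assume neg: "\<not> ?thesis"
      have "\<exists>c. \<forall>z. g k z = (\<Sum>i\<in>{..<n} - {k}. c i * g i z)"
        by (rule functional_in_span) (use lin k neg in auto)
      then obtain c where c: "\<And>z. g k z = (\<Sum>i\<in>{..<n} - {k}. c i * g i z)" by blast
      have "(\<Sum>i<n. (c(k := -1)) i * g i z) = 0" for z
      proof -
        have "(\<Sum>i<n. (c(k := -1)) i * g i z) = - g k z + (\<Sum>i\<in>{..<n} - {k}. (c(k := -1)) i * g i z)"
          using k by (subst sum.remove[of _ k]) auto
        also have "(\<Sum>i\<in>{..<n} - {k}. (c(k := -1)) i * g i z) = g k z"
          unfolding c by (intro sum.cong) auto
        finally show ?thesis by simp
      qed
      from ind[OF this k] show False by simp
    qed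
    then obtain z where z: "\<And>i. i < n \<Longrightarrow> i \<noteq> k \<Longrightarrow> g i z = 0" "g k z \<noteq> 0" by auto
    have "g i ((1 / g k z) *\<^sub>C z) = (if i = k then 1 else 0)" if "i < n" for i
      using z linear_functional_onD(2)[OF lin[OF that]] that by auto
    then show ?thesis by blast
  qed
  then obtain v where "\<And>k. k < n \<Longrightarrow> \<forall>i<n. g i (v k) = (if i = k then 1 else 0)" by metis
  then show thesis by (intro that[of v]) auto
qed

section \<open>The form induced by a minimal idempotent\<close>

locale minimal_idempotent =
  fixes e :: "'a::complex_banach_algebra_1" and \<phi> :: "'a \<Rightarrow> complex"
  assumes nonzero: "e \<noteq> 0" and idem: "e * e = e" and sandwich: "e * z * e = \<phi> z *\<^sub>C e"
    and minimal_socle: "minimal_two_sided_ideal (Soc :: 'a set)" and e_socle: "e \<in> Soc"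
begin

lemma sandwich': "e * (z * e) = \<phi> z *\<^sub>C e" "e * (z * (e * w)) = \<phi> z *\<^sub>C (e * w)"
proof -
  show "e * (z * e) = \<phi> z *\<^sub>C e" using sandwich[of z] by (simp add: mult.assoc)
  have "e * (z * (e * w)) = e * z * e * w" by (simp add: mult.assoc)
  then show "e * (z * (e * w)) = \<phi> z *\<^sub>C (e * w)" by (simp add: sandwich)
qed

lemma \<phi>_eqI: "e * z * e = c *\<^sub>C e \<Longrightarrow> \<phi> z = c"
  using nonzero by (simp add: sandwich)

lemma \<phi>_add: "\<phi> (z + w) = \<phi> z + \<phi> w"
  by (rule \<phi>_eqI) (simp add: distrib_left distrib_right sandwich scaleC.scale_left_distrib)

lemma \<phi>_scaleC: "\<phi> (c *\<^sub>C z) = c * \<phi> z"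
  by (rule \<phi>_eqI) (simp add: sandwich)

lemma \<phi>_one: "\<phi> 1 = 1"
  by (rule \<phi>_eqI) (simp add: idem)

lemma \<phi>_mult: "\<phi> (z * e * w) = \<phi> z * \<phi> w"
  by (rule \<phi>_eqI) (simp add: mult.assoc sandwich')

lemma linear_\<phi>: "linear_functional_on UNIV \<phi>"
  by (simp add: linear_functional_on_def \<phi>_add \<phi>_scaleC)

lemma linear_\<phi>_mult: "linear_functional_on UNIV (\<lambda>z. \<phi> (z * x))" "linear_functional_on UNIV (\<lambda>z. \<phi> (x * z))"
  by (simp_all add: linear_functional_on_def \<phi>_add \<phi>_scaleC distrib_left distrib_right)

lemma \<phi>_sum: "\<phi> (sum f I) = (\<Sum>i\<in>I. \<phi> (f i))"
  by (induction I rule: infinite_finite_induct) (simp_all add: \<phi>_add linear_functional_onD(3)[OF linear_\<phi>])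

lemma \<phi>_bound: "cmod (\<phi> z) \<le> norm e * norm z"
proof -
  have "cmod (\<phi> z) * norm e = norm (e * z * e)" by (simp add: sandwich norm_scaleC)
  also have "\<dots> \<le> norm (e * z) * norm e" by (rule norm_mult_ineq)
  also have "\<dots> \<le> (norm e * norm z) * norm e" by (intro mult_right_mono norm_mult_ineq) simp
  finally show ?thesis by (rule mult_right_le_imp_le) (use nonzero in simp)
qed

lemma tendsto_\<phi>:
  assumes "(f \<longlongrightarrow> l) F"
  shows "((\<lambda>k. \<phi> (f k)) \<longlongrightarrow> \<phi> l) F"
proof (rule LIM_zero_cancel, rule Lim_null_comparison)
  show "\<forall>\<^sub>F k in F. norm (\<phi> (f k) - \<phi> l) \<le> norm e * norm (f k - l)"
    unfolding linear_functional_onD(4)[OF linear_\<phi>, symmetric]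
    by (intro always_eventually allI \<phi>_bound)
  have "((\<lambda>k. norm e * norm (f k - l)) \<longlongrightarrow> norm e * norm (l - l)) F"
    by (intro tendsto_intros assms)
  then show "((\<lambda>k. norm e * norm (f k - l)) \<longlongrightarrow> 0) F" by simp
qed

lemma two_sided_ideal_socle: "two_sided_ideal (Soc :: 'a set)"
  using minimal_socle by (simp add: minimal_two_sided_ideal_def)

lemmas socleD = two_sided_idealD[OF two_sided_ideal_socle]

lemma socle_scaleC: "a \<in> Soc \<Longrightarrow> c *\<^sub>C a \<in> (Soc :: 'a set)"
  using socleD(3)[of a "c *\<^sub>C 1"] by simp

lemma socle_ideal_dichotomy:
  assumes "two_sided_ideal I" "I \<subseteq> (Soc :: 'a set)"
  shows "e \<notin> I \<Longrightarrow> I = {0}" "e \<in> I \<Longrightarrow> I = Soc"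
proof -
  have "I = {0} \<or> I = Soc" using assms minimal_socle by (simp add: minimal_two_sided_ideal_def)
  then show "e \<notin> I \<Longrightarrow> I = {0}" "e \<in> I \<Longrightarrow> I = Soc" using e_socle nonzero by auto
qed

text \<open>The socle elements b with e A b = 0 form a two-sided ideal that omits \<open>e\<close>,
  hence the zero ideal. It contains \<open>x * e\<close>, because e z x e = \<phi>(z x) e.\<close>

lemma left_nondegenerate:
  assumes "\<And>z. \<phi> (z * x) = 0"
  shows "x * e = 0"
proof -
  define I where "I = {b \<in> Soc. \<forall>z. e * z * b = 0}"
  have "two_sided_ideal I" unfolding two_sided_ideal_def left_ideal_def I_def
  proof (safe; (intro socleD allI; assumption)?)
    fix z a b :: 'a assume "\<forall>z. e * z * b = 0"
    then have "e * (z * a) * b = 0" by blast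
    then show "e * z * (a * b) = 0" by (simp add: mult.assoc)
  next
    fix z a b :: 'a assume "\<forall>z. e * z * b = 0"
    then have "e * z * b * a = 0" by simp
    then show "e * z * (b * a) = 0" by (simp add: mult.assoc)
  qed (simp_all add: distrib_left)
  moreover have "e * 1 * e \<noteq> 0" using idem nonzero by simp
  then have "e \<notin> I" unfolding I_def by blast
  ultimately have "I = {0}" using socle_ideal_dichotomy(1)[of I] by (auto simp: I_def)
  moreover have "x * e \<in> I"
    using assms socleD(3)[OF e_socle] by (auto simp: I_def mult.assoc sandwich'(1)[of "_ * _", unfolded mult.assoc])
  ultimately show ?thesis by simp
qed

text \<open>The argument of \<open>left_nondegenerate\<close> with sides exchanged, for the ideal of
  socle elements b with b A e = 0.\<close>

lemma right_nondegenerate: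
  assumes "\<And>z. \<phi> (y * z) = 0"
  shows "e * y = 0"
proof -
  define I where "I = {b \<in> Soc. \<forall>z. b * z * e = 0}"
  have "two_sided_ideal I" unfolding two_sided_ideal_def left_ideal_def I_def
  proof (safe; (intro socleD allI; assumption)?)
    fix z a b :: 'a assume "\<forall>z. b * z * e = 0"
    then have "b * (a * z) * e = 0" by blast
    then show "b * a * z * e = 0" by (simp add: mult.assoc)
  next
    fix z a b :: 'a assume "\<forall>z. b * z * e = 0"
    then have "a * (b * z * e) = 0" by simp
    then show "a * b * z * e = 0" by (simp add: mult.assoc)
  qed (simp_all add: distrib_right)
  moreover have "e * 1 * e \<noteq> 0" using idem nonzero by simp
  then have "e \<notin> I" unfolding I_def by blast
  ultimately have "I = {0}" using socle_ideal_dichotomy(1)[of I] by (auto simp: I_def)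
  moreover have "e * y \<in> I"
    using assms socleD(4)[OF e_socle] sandwich[of "y * _"] by (auto simp: I_def mult.assoc)
  ultimately show ?thesis by simp
qed

section \<open>Sums of rank-one elements and their Gram matrices\<close>

definition rank_one_sum :: "nat \<Rightarrow> (nat \<Rightarrow> 'a) \<Rightarrow> (nat \<Rightarrow> 'a) \<Rightarrow> 'a" where
  "rank_one_sum n x y = (\<Sum>i<n. x i * e * y i)"

definition gram :: "(nat \<Rightarrow> 'a) \<Rightarrow> (nat \<Rightarrow> 'a) \<Rightarrow> nat \<Rightarrow> nat \<Rightarrow> complex" where
  "gram x y i j = \<phi> (y i * x j)"

lemma mult_rank_one_sum: "u * rank_one_sum n x y = rank_one_sum n (\<lambda>i. u * x i) y"
  by (simp add: rank_one_sum_def sum_distrib_left mult.assoc)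

lemma rank_one_sum_mult: "rank_one_sum n x y * u = rank_one_sum n x (\<lambda>i. y i * u)"
  by (simp add: rank_one_sum_def sum_distrib_right mult.assoc)

lemma rank_one_sum_apply:
  "rank_one_sum n x y * (\<Sum>j<n. c j *\<^sub>C (x j * e)) = (\<Sum>i<n. (\<Sum>j<n. gram x y i j * c j) *\<^sub>C (x i * e))"
proof -
  have "rank_one_sum n x y * (\<Sum>j<n. c j *\<^sub>C (x j * e)) = (\<Sum>i<n. \<Sum>j<n. c j *\<^sub>C (x i * (e * (y i * x j * e))))"
    by (simp add: rank_one_sum_def sum_product mult.assoc)
  also have "\<dots> = (\<Sum>i<n. \<Sum>j<n. (gram x y i j * c j) *\<^sub>C (x i * e))"
    unfolding sandwich' gram_def by (simp add: mult.commute)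
  finally show ?thesis by (simp add: scaleC.scale_sum_left)
qed

text \<open>An eigenvector c of the Gram matrix lifts to the sum of the c_j x_j e. The last
  conclusion reads z c_i back off the lift, which shows that it is nonzero when z is.\<close>

lemma gram_root_eigenvector:
  assumes "poly (charpoly n (gram x y)) z = 0"
  obtains c where "\<exists>i<n. c i \<noteq> 0"
    "rank_one_sum n x y * (\<Sum>j<n. c j *\<^sub>C (x j * e)) = z *\<^sub>C (\<Sum>j<n. c j *\<^sub>C (x j * e))"
    "\<And>i. i < n \<Longrightarrow> e * y i * (\<Sum>j<n. c j *\<^sub>C (x j * e)) = (z * c i) *\<^sub>C e"
proof -
  obtain c where c: "\<exists>i<n. c i \<noteq> 0" "\<And>i. i < n \<Longrightarrow> (\<Sum>j<n. gram x y i j * c j) = z * c i"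
    using assms unfolding charpoly_root_iff by blast
  have "e * y i * (\<Sum>j<n. c j *\<^sub>C (x j * e)) = (z * c i) *\<^sub>C e" if "i < n" for i
  proof -
    have "e * y i * (\<Sum>j<n. c j *\<^sub>C (x j * e)) = (\<Sum>j<n. c j *\<^sub>C (e * (y i * x j * e)))"
      by (simp add: sum_distrib_left mult.assoc)
    also have "\<dots> = (\<Sum>j<n. gram x y i j * c j) *\<^sub>C e"
      unfolding sandwich' gram_def by (simp add: mult.commute scaleC.scale_sum_left)
    finally show ?thesis using c(2)[OF that] by simp
  qed
  moreover have "rank_one_sum n x y * (\<Sum>j<n. c j *\<^sub>C (x j * e)) = z *\<^sub>C (\<Sum>j<n. c j *\<^sub>C (x j * e))"
    unfolding rank_one_sum_apply by (simp add: c(2) scaleC.scale_sum_right)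
  ultimately show thesis using c(1) that by blast
qed

text \<open>With a = X e Y and H the inverse of z - G for the Gram matrix G, the inverse of z - a is
  (1 + T) / z, where T sums the H_ij x_i e y_j. This is the usual passage between the resolvents of
  a product and of the product in reverse order.\<close>

lemma gram_nonroot_resolvent:
  assumes z: "z \<noteq> 0" and nonroot: "poly (charpoly n (gram x y)) z \<noteq> 0"
  shows "z \<notin> spectrum (rank_one_sum n x y)"
proof -
  obtain H where
    H1: "\<And>i k. i < n \<Longrightarrow> k < n \<Longrightarrow> z * H i k - (\<Sum>j<n. gram x y i j * H j k) = (if i = k then 1 else 0)"
    and H2: "\<And>i k. i < n \<Longrightarrow> k < n \<Longrightarrow> z * H i k - (\<Sum>j<n. H i j * gram x y j k) = (if i = k then 1 else 0)"
    using charpoly_nonroot_inverse[OF nonroot] by blast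
  let ?a = "rank_one_sum n x y"
  let ?T = "\<lambda>K. \<Sum>i<n. \<Sum>j<n. K i j *\<^sub>C (x i * e * y j)"
  have a: "?a = ?T (\<lambda>i j. if i = j then 1 else 0)"
  proof -
    have "?T (\<lambda>i j. if i = j then 1 else 0) = (\<Sum>i<n. \<Sum>j<n. if i = j then x i * e * y i else 0)"
      by (intro sum.cong) auto
    then show ?thesis by (simp add: rank_one_sum_def sum.delta')
  qed
  have aT: "?a * ?T K = ?T (\<lambda>i k. \<Sum>j<n. gram x y i j * K j k)" for K
  proof -
    have "?a * ?T K = (\<Sum>i<n. \<Sum>j<n. \<Sum>k<n. K j k *\<^sub>C (x i * (e * (y i * x j * (e * y k)))))"
      unfolding rank_one_sum_def sum_distrib_right by (simp add: sum_distrib_left mult.assoc)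
    also have "\<dots> = (\<Sum>i<n. \<Sum>j<n. \<Sum>k<n. (gram x y i j * K j k) *\<^sub>C (x i * e * y k))"
      unfolding sandwich' gram_def by (simp add: mult.commute mult.assoc)
    also have "\<dots> = (\<Sum>i<n. \<Sum>k<n. \<Sum>j<n. (gram x y i j * K j k) *\<^sub>C (x i * e * y k))"
      by (intro sum.cong refl sum.swap)
    finally show ?thesis by (simp add: scaleC.scale_sum_left)
  qed
  have Ta: "?T K * ?a = ?T (\<lambda>i k. \<Sum>j<n. K i j * gram x y j k)" for K
  proof -
    have "?T K * ?a = (\<Sum>i<n. \<Sum>j<n. \<Sum>k<n. K i j *\<^sub>C (x i * (e * (y j * x k * (e * y k)))))"
      unfolding rank_one_sum_def sum_distrib_right by (simp add: sum_distrib_left mult.assoc)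
    also have "\<dots> = (\<Sum>i<n. \<Sum>j<n. \<Sum>k<n. (K i j * gram x y j k) *\<^sub>C (x i * e * y k))"
      unfolding sandwich' gram_def by (simp add: mult.commute mult.assoc)
    also have "\<dots> = (\<Sum>i<n. \<Sum>k<n. \<Sum>j<n. (K i j * gram x y j k) *\<^sub>C (x i * e * y k))"
      by (intro sum.cong refl sum.swap)
    finally show ?thesis by (simp add: scaleC.scale_sum_left)
  qed
  have diff: "z *\<^sub>C ?T H - ?T K = ?a"
    if "\<And>i k. i < n \<Longrightarrow> k < n \<Longrightarrow> z * H i k - K i k = (if i = k then 1 else 0)" for K
  proof -
    have "z *\<^sub>C ?T H - ?T K = (\<Sum>i<n. \<Sum>j<n. (z * H i j - K i j) *\<^sub>C (x i * e * y j))"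
      by (simp add: scaleC.scale_sum_right sum_subtractf scaleC.scale_left_diff_distrib)
    also have "\<dots> = ?a" unfolding a using that by (intro sum.cong) auto
    finally show ?thesis .
  qed
  have 1: "z *\<^sub>C ?T H - ?a * ?T H = ?a" unfolding aT by (rule diff[OF H1])
  have 2: "z *\<^sub>C ?T H - ?T H * ?a = ?a" unfolding Ta by (rule diff[OF H2])
  define T where "T = ?T H"
  show ?thesis
  proof (rule not_in_spectrumI[of _ _ "inverse z *\<^sub>C (1 + T)"])
    have "(z *\<^sub>C 1 - ?a) * (1 + T) = z *\<^sub>C 1 + ((z *\<^sub>C T - ?a * T) - ?a)"
      by (simp add: algebra_simps)
    also have "\<dots> = z *\<^sub>C 1" using 1 by (simp add: T_def)
    finally show "(z *\<^sub>C 1 - ?a) * (inverse z *\<^sub>C (1 + T)) = 1" using z by simp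
    have "(1 + T) * (z *\<^sub>C 1 - ?a) = z *\<^sub>C 1 + ((z *\<^sub>C T - T * ?a) - ?a)"
      by (simp add: algebra_simps)
    also have "\<dots> = z *\<^sub>C 1" using 2 by (simp add: T_def)
    finally show "(inverse z *\<^sub>C (1 + T)) * (z *\<^sub>C 1 - ?a) = 1" using z by simp
  qed
qed

lemma nonzero_spectrum_rank_one_sum:
  "nonzero_spectrum (rank_one_sum n x y) = {z. z \<noteq> 0 \<and> poly (charpoly n (gram x y)) z = 0}"
proof -
  have "z \<in> spectrum (rank_one_sum n x y)" if z: "z \<noteq> 0" "poly (charpoly n (gram x y)) z = 0" for z
  proof -
    obtain c where c: "\<exists>i<n. c i \<noteq> 0"
      "rank_one_sum n x y * (\<Sum>j<n. c j *\<^sub>C (x j * e)) = z *\<^sub>C (\<Sum>j<n. c j *\<^sub>C (x j * e))"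
      "\<And>i. i < n \<Longrightarrow> e * y i * (\<Sum>j<n. c j *\<^sub>C (x j * e)) = (z * c i) *\<^sub>C e"
      using gram_root_eigenvector[OF z(2)] by blast
    then obtain i where i: "i < n" "c i \<noteq> 0" by blast
    have "(\<Sum>j<n. c j *\<^sub>C (x j * e)) \<noteq> 0"
    proof
      assume "(\<Sum>j<n. c j *\<^sub>C (x j * e)) = 0"
      then have "(z * c i) *\<^sub>C e = 0" using c(3)[OF i(1)] by simp
      then show False using i(2) z(1) nonzero by simp
    qed
    then show ?thesis by (rule spectrum_memI_right[OF c(2)])
  qed
  then show ?thesis unfolding nonzero_spectrum_def using gram_nonroot_resolvent by blast
qed

end

subsection \<open>Reduced representations\<close>

lemma scaleC_solve:
  fixes v s :: "'a::complex_banach_algebra_1"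
  assumes "c \<noteq> 0" "c *\<^sub>C v + s = 0"
  shows "v = - inverse c *\<^sub>C s"
proof -
  have "s = - (c *\<^sub>C v)" using assms(2) by (simp add: eq_neg_iff_add_eq_0 add.commute)
  then show ?thesis using assms(1) by simp
qed

lemma remove_index_bij:
  assumes "k < Suc n"
  obtains h :: "nat \<Rightarrow> nat" where "bij_betw h {..<n} ({..<Suc n} - {k})"
proof -
  have "card ({..<Suc n} - {k}) = n" using assms by simp
  then show thesis
    using that ex_bij_betw_nat_finite[of "{..<Suc n} - {k}"] by (auto simp: atLeast0LessThan)
qed

context minimal_idempotent
begin

definition reduced :: "nat \<Rightarrow> (nat \<Rightarrow> 'a) \<Rightarrow> (nat \<Rightarrow> 'a) \<Rightarrow> bool" where
  "reduced n x y \<longleftrightarrow>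
     (\<forall>c. (\<Sum>i<n. c i *\<^sub>C (x i * e)) = 0 \<longrightarrow> (\<forall>i<n. c i = 0)) \<and>
     (\<forall>c. (\<Sum>i<n. c i *\<^sub>C (e * y i)) = 0 \<longrightarrow> (\<forall>i<n. c i = 0))"

lemma rank_one_sum_add: "\<exists>p u v. rank_one_sum n x y + rank_one_sum m x' y' = rank_one_sum p u v"
proof (induction m)
  case 0
  show ?case by (auto simp: rank_one_sum_def)
next
  case (Suc m)
  then obtain p u v where *: "rank_one_sum n x y + rank_one_sum m x' y' = rank_one_sum p u v" by blast
  have "rank_one_sum n x y + rank_one_sum (Suc m) x' y' = rank_one_sum p u v + x' m * e * y' m"
    by (simp add: rank_one_sum_def flip: *[unfolded rank_one_sum_def])
  also have "\<dots> = rank_one_sum (Suc p) (u(p := x' m)) (v(p := y' m))"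
    by (simp add: rank_one_sum_def)
  finally show ?case by blast
qed

text \<open>The sums form a two-sided ideal inside the socle that contains \<open>e\<close>, hence
  all of the socle.\<close>

lemma socle_rank_one_sum:
  assumes "a \<in> Soc"
  shows "\<exists>n x y. a = rank_one_sum n x y"
proof -
  define J where "J = {a. \<exists>n x y. a = rank_one_sum n x y}"
  have mem: "rank_one_sum n x y \<in> J" for n x y unfolding J_def by blast
  have "two_sided_ideal J"
    unfolding two_sided_ideal_def left_ideal_def
  proof (intro conjI ballI allI)
    show "0 \<in> J" using mem[of 0] by (simp add: rank_one_sum_def)
    show "a + b \<in> J" if "a \<in> J" "b \<in> J" for a b
      using that rank_one_sum_add unfolding J_def by blast
    show "u * a \<in> J" "a * u \<in> J" if "a \<in> J" for a u
      using that mem unfolding J_def by (auto simp: mult_rank_one_sum rank_one_sum_mult)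
  qed
  moreover have "J \<subseteq> Soc"
  proof -
    have "rank_one_sum n x y \<in> Soc" for n x y
      unfolding rank_one_sum_def
      by (induction n) (auto intro: socleD(1-4) e_socle)
    then show ?thesis by (auto simp: J_def)
  qed
  moreover have "e \<in> J" using mem[of 1 "\<lambda>_. 1" "\<lambda>_. 1"] by (simp add: rank_one_sum_def)
  ultimately have "J = Soc" by (intro socle_ideal_dichotomy(2))
  then show ?thesis using assms by (auto simp: J_def)
qed

text \<open>A linear relation expresses one factor through the others; its term is absorbed into the
  remaining ones, and \<open>h\<close> renumbers the n indices left.\<close>

lemma rank_one_sum_shorten:
  assumes "\<not> reduced (Suc n) x y"
  shows "\<exists>x' y'. rank_one_sum (Suc n) x y = rank_one_sum n x' y'"
proof -
  consider c k where "(\<Sum>i<Suc n. c i *\<^sub>C (x i * e)) = 0" "k < Suc n" "c k \<noteq> 0"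
    | c k where "(\<Sum>i<Suc n. c i *\<^sub>C (e * y i)) = 0" "k < Suc n" "c k \<noteq> 0"
    using assms unfolding reduced_def by blast
  then show ?thesis
  proof cases
    case (1 c k)
    let ?S = "{..<Suc n} - {k}"
    obtain h :: "nat \<Rightarrow> nat" where h: "bij_betw h {..<n} ?S" using remove_index_bij[OF 1(2)] .
    have "c k *\<^sub>C (x k * e) + (\<Sum>i\<in>?S. c i *\<^sub>C (x i * e)) = 0"
      using 1(1,2) sum.remove[of "{..<Suc n}" k "\<lambda>i. c i *\<^sub>C (x i * e)"] by simp
    then have "x k * e = - inverse (c k) *\<^sub>C (\<Sum>i\<in>?S. c i *\<^sub>C (x i * e))"
      by (rule scaleC_solve[OF 1(3)])
    then have xk: "x k * e * y k = (\<Sum>i\<in>?S. x i * e * ((- inverse (c k) * c i) *\<^sub>C y k))"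
      by (simp only: scaleC.scale_sum_right sum_distrib_right scaleC_scaleC mult_scaleC_left mult_scaleC_right)
    have "rank_one_sum (Suc n) x y = x k * e * y k + (\<Sum>i\<in>?S. x i * e * y i)"
      unfolding rank_one_sum_def using 1(2) by (intro sum.remove) auto
    also have "\<dots> = (\<Sum>i\<in>?S. x i * e * ((- inverse (c k) * c i) *\<^sub>C y k + y i))"
      unfolding xk distrib_left sum.distrib ..
    also have "\<dots> = rank_one_sum n (\<lambda>i. x (h i)) (\<lambda>i. (- inverse (c k) * c (h i)) *\<^sub>C y k + y (h i))"
      unfolding rank_one_sum_def by (rule sum.reindex_bij_betw[OF h, symmetric])
    finally show ?thesis by blast
  next
    case (2 c k)
    let ?S = "{..<Suc n} - {k}"
    obtain h :: "nat \<Rightarrow> nat" where h: "bij_betw h {..<n} ?S" using remove_index_bij[OF 2(2)] .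
    have "c k *\<^sub>C (e * y k) + (\<Sum>i\<in>?S. c i *\<^sub>C (e * y i)) = 0"
      using 2(1,2) sum.remove[of "{..<Suc n}" k "\<lambda>i. c i *\<^sub>C (e * y i)"] by simp
    then have "e * y k = - inverse (c k) *\<^sub>C (\<Sum>i\<in>?S. c i *\<^sub>C (e * y i))"
      by (rule scaleC_solve[OF 2(3)])
    then have yk: "x k * e * y k = (\<Sum>i\<in>?S. ((- inverse (c k) * c i) *\<^sub>C x k) * e * y i)"
      by (simp only: scaleC.scale_sum_right sum_distrib_left scaleC_scaleC mult_scaleC_left mult_scaleC_right mult.assoc)
    have "rank_one_sum (Suc n) x y = x k * e * y k + (\<Sum>i\<in>?S. x i * e * y i)"
      unfolding rank_one_sum_def using 2(2) by (intro sum.remove) auto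
    also have "\<dots> = (\<Sum>i\<in>?S. ((- inverse (c k) * c i) *\<^sub>C x k + x i) * e * y i)"
      unfolding yk distrib_right sum.distrib ..
    also have "\<dots> = rank_one_sum n (\<lambda>i. (- inverse (c k) * c (h i)) *\<^sub>C x k + x (h i)) (\<lambda>i. y (h i))"
      unfolding rank_one_sum_def by (rule sum.reindex_bij_betw[OF h, symmetric])
    finally show ?thesis by blast
  qed
qed

lemma reduced_representation:
  assumes "a \<in> Soc"
  obtains n x y where "a = rank_one_sum n x y" "reduced n x y"
proof -
  let ?P = "\<lambda>n. \<exists>x y. a = rank_one_sum n x y"
  have ex: "\<exists>n. ?P n" using socle_rank_one_sum[OF assms] by blast
  define n where "n = (LEAST n. ?P n)"
  have "?P n" unfolding n_def using ex by (rule LeastI_ex)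
  then obtain x y where a: "a = rank_one_sum n x y" by blast
  have "reduced n x y"
  proof (cases n)
    case 0
    then show ?thesis by (simp add: reduced_def)
  next
    case (Suc m)
    have "\<not> ?P m" by (rule not_less_Least) (use Suc n_def in simp)
    then show ?thesis using rank_one_sum_shorten a Suc by metis
  qed
  with a show thesis by (rule that)
qed

text \<open>Nondegeneracy makes the functionals \<phi>(z x_i) of z independent, and likewise the
  \<phi>(y_i z), so dual vectors \<open>w k\<close> and \<open>z k\<close> exist. Since \<phi> is
  multiplicative across \<open>e\<close>, the term z_k e w_l of \<open>u\<close> contributes the
  matrix unit at (k, l).\<close>

lemma reduced_gram_surj:
  assumes "reduced n x y"
  obtains u where "\<And>i j. i < n \<Longrightarrow> j < n \<Longrightarrow> gram (\<lambda>j. u * x j) y i j = B i j"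
proof -
  obtain w where w: "\<And>i k. i < n \<Longrightarrow> k < n \<Longrightarrow> \<phi> (w k * x i) = (if i = k then 1 else 0)"
  proof (rule dual_vectors_exist[of n "\<lambda>i z. \<phi> (z * x i)"])
    fix c i assume *: "\<And>z. (\<Sum>i<n. c i * \<phi> (z * x i)) = 0" and i: "i < n"
    have "\<phi> (z * (\<Sum>i<n. c i *\<^sub>C x i)) = 0" for z
      using *[of z] by (simp add: sum_distrib_left \<phi>_sum \<phi>_scaleC)
    then have "(\<Sum>i<n. c i *\<^sub>C x i) * e = 0" by (rule left_nondegenerate)
    then have "(\<Sum>i<n. c i *\<^sub>C (x i * e)) = 0" by (simp add: sum_distrib_right)
    then show "c i = 0" using assms i unfolding reduced_def by blast
  qed (rule linear_\<phi>_mult, blast)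
  obtain z where z: "\<And>i k. i < n \<Longrightarrow> k < n \<Longrightarrow> \<phi> (y i * z k) = (if i = k then 1 else 0)"
  proof (rule dual_vectors_exist[of n "\<lambda>i z. \<phi> (y i * z)"])
    fix c i assume *: "\<And>z. (\<Sum>i<n. c i * \<phi> (y i * z)) = 0" and i: "i < n"
    have "\<phi> ((\<Sum>i<n. c i *\<^sub>C y i) * z) = 0" for z
      using *[of z] by (simp add: sum_distrib_right \<phi>_sum \<phi>_scaleC)
    then have "e * (\<Sum>i<n. c i *\<^sub>C y i) = 0" by (rule right_nondegenerate)
    then have "(\<Sum>i<n. c i *\<^sub>C (e * y i)) = 0" by (simp add: sum_distrib_left)
    then show "c i = 0" using assms i unfolding reduced_def by blast
  qed (rule linear_\<phi>_mult, blast)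
  define u where "u = (\<Sum>k<n. \<Sum>l<n. B k l *\<^sub>C (z k * e * w l))"
  have "gram (\<lambda>j. u * x j) y i j = B i j" if ij: "i < n" "j < n" for i j
  proof -
    have "y i * (u * x j) = (\<Sum>k<n. \<Sum>l<n. B k l *\<^sub>C (y i * z k * e * (w l * x j)))"
      unfolding u_def sum_distrib_left sum_distrib_right by (simp add: mult.assoc)
    then have "gram (\<lambda>j. u * x j) y i j = (\<Sum>k<n. \<Sum>l<n. B k l * (\<phi> (y i * z k) * \<phi> (w l * x j)))"
      by (simp only: gram_def \<phi>_sum \<phi>_scaleC \<phi>_mult)
    also have "\<dots> = (\<Sum>k<n. \<Sum>l<n. if l = j then if k = i then B k l else 0 else 0)"
      using ij by (intro sum.cong) (auto simp: w z)
    also have "\<dots> = B i j" using ij by (simp add: sum.delta)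
    finally show ?thesis .
  qed
  then show thesis by (rule that)
qed

text \<open>The value z = 0 is included: the lifted eigenvector is nonzero because the
  \<open>x j * e\<close> are independent.\<close>

lemma gram_root_in_spectrum:
  assumes "reduced n x y" "poly (charpoly n (gram x y)) z = 0"
  shows "z \<in> spectrum (rank_one_sum n x y)"
proof -
  obtain c where c: "\<exists>i<n. c i \<noteq> 0"
    "rank_one_sum n x y * (\<Sum>j<n. c j *\<^sub>C (x j * e)) = z *\<^sub>C (\<Sum>j<n. c j *\<^sub>C (x j * e))"
    using gram_root_eigenvector[OF assms(2)] by blast
  have "(\<Sum>j<n. c j *\<^sub>C (x j * e)) \<noteq> 0" using c(1) assms(1) unfolding reduced_def by blast
  then show ?thesis by (rule spectrum_memI_right[OF c(2)])
qed

end

subsection \<open>Multiplicities and the trace\<close>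

lemma finite_nonzero_spectrum_iff: "finite (nonzero_spectrum a) \<longleftrightarrow> finite (spectrum a)"
  by (simp add: nonzero_spectrum_def)

context minimal_idempotent
begin

lemma nonzero_spectrum_mult_rank_one_sum:
  "nonzero_spectrum (u * rank_one_sum n x y) =
    {z. z \<noteq> 0 \<and> poly (charpoly n (gram (\<lambda>i. u * x i) y)) z = 0}"
  by (simp add: mult_rank_one_sum nonzero_spectrum_rank_one_sum)

lemma nonzero_spectrum_mult_finite: "finite (nonzero_spectrum (u * rank_one_sum n x y))"
  and nonzero_spectrum_mult_card: "card (nonzero_spectrum (u * rank_one_sum n x y)) \<le> n"
proof -
  let ?p = "charpoly n (gram (\<lambda>i. u * x i) y)"
  have fin: "finite {z. poly ?p z = 0}" by (rule poly_roots_finite[OF charpoly_nonzero])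
  have sub: "nonzero_spectrum (u * rank_one_sum n x y) \<subseteq> {z. poly ?p z = 0}"
    by (auto simp: nonzero_spectrum_mult_rank_one_sum)
  show "finite (nonzero_spectrum (u * rank_one_sum n x y))" by (rule finite_subset[OF sub fin])
  have "card (nonzero_spectrum (u * rank_one_sum n x y)) \<le> card {z. poly ?p z = 0}"
    by (rule card_mono[OF fin sub])
  also have "\<dots> \<le> n" using card_poly_roots_bound[OF charpoly_nonzero, of n] by (simp add: degree_charpoly)
  finally show "card (nonzero_spectrum (u * rank_one_sum n x y)) \<le> n" .
qed

text \<open>Moving along 1 + t u0, where \<open>u0\<close> has Gram matrix \<open>D\<close>,
  realizes the Schur perturbation of the eigenvalues; all but finitely many t make them distinct and
  nonzero.\<close>

lemma card_nonzero_spectrum_dense: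
  assumes red: "reduced n x y" and "\<epsilon> > 0"
  shows "\<exists>u\<in>ball 1 \<epsilon>. card (nonzero_spectrum (u * rank_one_sum n x y)) = n"
proof -
  obtain es D where es: "length es = n"
    and pert: "\<And>t. charpoly n (\<lambda>i j. gram x y i j + t * D i j) =
      (\<Prod>i\<leftarrow>[0..<n]. [:- (es ! i + t * of_nat (i + 1)), 1:])"
    by (rule charpoly_schur_perturbation[of n "gram x y"]) blast
  obtain u0 where u0: "\<And>i j. i < n \<Longrightarrow> j < n \<Longrightarrow> gram (\<lambda>j. u0 * x j) y i j = D i j"
    using reduced_gram_surj[OF red, of D] by blast
  \<comment> \<open>The t for which an eigenvalue vanishes or two coincide. Pairs with i = j
    contribute only 0, since 0 / 0 = 0, and the chosen t is positive.\<close>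
  define bad where "bad = (\<lambda>i. - (es ! i) / of_nat (i + 1)) ` {..<n} \<union>
    (\<lambda>(i, j). (es ! j - es ! i) / (of_nat i - of_nat j)) ` ({..<n} \<times> {..<n})"
  have "finite bad" unfolding bad_def by auto
  define \<delta> where "\<delta> = \<epsilon> / (norm u0 + 1)"
  have "\<delta> > 0" using \<open>\<epsilon> > 0\<close> by (simp add: \<delta>_def add_nonneg_pos)
  have "infinite (complex_of_real ` {0<..<\<delta>})"
    using \<open>\<delta> > 0\<close> by (subst finite_image_iff) (auto simp: inj_on_def infinite_Ioo)
  then have "\<not> complex_of_real ` {0<..<\<delta>} \<subseteq> bad" using \<open>finite bad\<close> finite_subset by blast
  then obtain t where "t \<in> {0<..<\<delta>}" and t3: "complex_of_real t \<notin> bad" by blast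
  then have t: "t > 0" "t < \<delta>" by auto
  define u where "u = 1 + of_real t *\<^sub>C u0"
  have "dist 1 u = t * norm u0" using t(1) by (simp add: u_def dist_norm norm_scaleC)
  also have "\<dots> < \<epsilon>"
  proof -
    have "t * norm u0 \<le> t * (norm u0 + 1)" using t(1) by simp
    also have "\<dots> < \<delta> * (norm u0 + 1)" using t(2) by (intro mult_strict_right_mono) (auto simp: add_nonneg_pos)
    also have "\<dots> = \<epsilon>"
    proof -
      have "norm u0 + 1 \<noteq> 0" using norm_ge_zero[of u0] by linarith
      then show ?thesis by (simp add: \<delta>_def)
    qed
    finally show ?thesis .
  qed
  finally have "u \<in> ball 1 \<epsilon>" by simp
  define \<mu> where "\<mu> i = es ! i + of_real t * of_nat (i + 1)" for i
  have "charpoly n (gram (\<lambda>i. u * x i) y) = charpoly n (\<lambda>i j. gram x y i j + of_real t * D i j)"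
  proof (rule charpoly_cong)
    fix i j assume "i < n" "j < n"
    from u0[OF this, symmetric] show "gram (\<lambda>i. u * x i) y i j = gram x y i j + of_real t * D i j"
      by (simp add: gram_def u_def distrib_left distrib_right \<phi>_add \<phi>_scaleC)
  qed
  also have "\<dots> = (\<Prod>i\<leftarrow>[0..<n]. [:- \<mu> i, 1:])" unfolding pert \<mu>_def ..
  finally have P: "charpoly n (gram (\<lambda>i. u * x i) y) = (\<Prod>i\<leftarrow>[0..<n]. [:- \<mu> i, 1:])" .
  have root: "poly (charpoly n (gram (\<lambda>i. u * x i) y)) z = 0 \<longleftrightarrow> z \<in> \<mu> ` {..<n}" for z
    unfolding P by (auto simp: poly_prod_list prod_list_zero_iff)
  have "\<mu> i \<noteq> 0" if "i < n" for i
  proof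
    assume "\<mu> i = 0"
    then have "of_real t * of_nat (i + 1) = - (es ! i)" by (simp add: \<mu>_def add_eq_0_iff)
    then have "of_real t = - (es ! i) / of_nat (i + 1)"
      by (rule nonzero_eq_divide_eq[THEN iffD2, rotated]) (use of_nat_neq_0[of i] in simp)
    then show False using t3 that unfolding bad_def by blast
  qed
  then have "nonzero_spectrum (u * rank_one_sum n x y) = \<mu> ` {..<n}"
    unfolding nonzero_spectrum_mult_rank_one_sum root by auto
  moreover have "inj_on \<mu> {..<n}"
  proof (rule inj_onI, rule ccontr)
    fix i j assume ij: "i \<in> {..<n}" "j \<in> {..<n}" "\<mu> i = \<mu> j" "i \<noteq> j"
    then have "of_real t * (of_nat i - of_nat j) = es ! j - es ! i" by (simp add: \<mu>_def algebra_simps)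
    then have "of_real t = (es ! j - es ! i) / (of_nat i - of_nat j)"
      using ij(4) by (simp add: nonzero_eq_divide_eq)
    then have "of_real t = (\<lambda>(i, j). (es ! j - es ! i) / (of_nat i - of_nat j)) (i, j)" by simp
    then show False using t3 ij(1,2) unfolding bad_def by blast
  qed
  ultimately have "card (nonzero_spectrum (u * rank_one_sum n x y)) = n" by (simp add: card_image)
  with \<open>u \<in> ball 1 \<epsilon>\<close> show ?thesis by blast
qed

lemma elem_rank_rank_one_sum:
  assumes "reduced n x y"
  shows "elem_rank (rank_one_sum n x y) = enat n"
proof (rule antisym)
  show "elem_rank (rank_one_sum n x y) \<le> enat n" unfolding elem_rank_def
    by (intro SUP_least) (simp add: ecard_def nonzero_spectrum_mult_finite nonzero_spectrum_mult_card)
  obtain u where "card (nonzero_spectrum (u * rank_one_sum n x y)) = n"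
    using card_nonzero_spectrum_dense[OF assms, of 1] by auto
  then show "enat n \<le> elem_rank (rank_one_sum n x y)"
    using ecard_nonzero_spectrum_le_rank[of u "rank_one_sum n x y"]
    by (simp add: ecard_def nonzero_spectrum_mult_finite)
qed

lemma rank_attaining_rank_one_sum:
  assumes "reduced n x y"
  shows "rank_attaining (rank_one_sum n x y) = {u. card (nonzero_spectrum (u * rank_one_sum n x y)) = n}"
  unfolding rank_attaining_def elem_rank_rank_one_sum[OF assms]
  by (simp add: ecard_def nonzero_spectrum_mult_finite)

lemma tendsto_charpoly_gram:
  assumes "(u \<longlongrightarrow> v) F"
  shows "((\<lambda>k. poly (charpoly n (gram (\<lambda>i. u k * x i) y)) z) \<longlongrightarrow>
    poly (charpoly n (gram (\<lambda>i. v * x i) y)) z) F"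
  unfolding gram_def by (intro tendsto_poly_charpoly tendsto_\<phi> tendsto_intros assms)

text \<open>When \<open>u\<close> attains the rank, the n roots of its characteristic polynomial are
  nonzero and pairwise different, so spectral points in the disc are counted by roots in the disc. A
  sequence of counterexamples tending to 1 contradicts \<open>root_count_limit\<close>.\<close>

lemma spectral_count_near_one:
  assumes red: "reduced n x y" and es: "length es = n" "charpoly n (gram x y) = (\<Prod>e\<leftarrow>es. [:- e, 1:])"
    and w: "w \<noteq> 0" and r: "r > 0" "closure (ball w r) \<inter> spectrum (rank_one_sum n x y) \<subseteq> {w}"
  shows "\<exists>\<epsilon>>0. \<forall>u \<in> rank_attaining (rank_one_sum n x y) \<inter> ball 1 \<epsilon>.
    ecard (spectrum (u * rank_one_sum n x y) \<inter> ball w r) = enat (card {i. i < n \<and> es ! i = w})"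
proof (rule ccontr)
  let ?a = "rank_one_sum n x y"
  let ?m = "card {i. i < n \<and> es ! i = w}"
  assume neg: "\<not> ?thesis"
  have "\<exists>u. u \<in> rank_attaining ?a \<and> u \<in> ball 1 (inverse (real (Suc k))) \<and>
      ecard (spectrum (u * ?a) \<inter> ball w r) \<noteq> enat ?m" for k
  proof -
    have "inverse (real (Suc k)) > 0" by simp
    then show ?thesis using neg by (meson IntE)
  qed
  then obtain u where u: "\<And>k. u k \<in> rank_attaining ?a"
    "\<And>k. u k \<in> ball 1 (inverse (real (Suc k)))"
    "\<And>k. ecard (spectrum (u k * ?a) \<inter> ball w r) \<noteq> enat ?m" by metis
  have dist_u: "dist (u k) 1 < inverse (real (Suc k))" for k
    using u(2)[of k] by (simp add: dist_commute)
  have "(\<lambda>k. dist (u k) 1) \<longlonglongrightarrow> 0"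
  proof (rule tendsto_sandwich[where f = "\<lambda>_. 0" and h = "\<lambda>k. inverse (real (Suc k))"])
    show "\<forall>\<^sub>F k in sequentially. dist (u k) 1 \<le> inverse (real (Suc k))"
      using dist_u by (intro always_eventually allI less_imp_le)
    show "(\<lambda>k. inverse (real (Suc k))) \<longlonglongrightarrow> 0" by (rule LIMSEQ_inverse_real_of_nat)
    show "\<forall>\<^sub>F k in sequentially. 0 \<le> dist (u k) 1" by simp
    show "(\<lambda>k. 0 :: real) \<longlonglongrightarrow> 0" by simp
  qed
  then have u_lim: "u \<longlonglongrightarrow> 1" by (rule tendsto_dist_iff[THEN iffD2])
  have u_near: "norm (1 - u k) < 1" for k
  proof -
    have "norm (1 - u k) < inverse (real (Suc k))" using dist_u[of k] by (simp add: dist_norm norm_minus_commute)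
    also have "\<dots> \<le> 1" by (simp add: inverse_le_1_iff)
    finally show ?thesis .
  qed
  let ?p = "\<lambda>k. charpoly n (gram (\<lambda>i. u k * x i) y)"
  have "\<exists>fs. ?p k = (\<Prod>f\<leftarrow>fs. [:- f, 1:]) \<and> length fs = n" for k
    by (rule charpoly_factorization[of n "gram (\<lambda>i. u k * x i) y"]) blast
  then obtain fs where fs: "\<And>k. ?p k = (\<Prod>f\<leftarrow>fs k. [:- f, 1:])" "\<And>k. length (fs k) = n" by metis
  have prod_nth: "poly (\<Prod>f\<leftarrow>l. [:- f, 1:]) z = (\<Prod>i<n. z - l ! i)" if "length l = n" for l and z :: complex
    using that by (simp add: prod.list_conv_set_nth poly_prod atLeast0LessThan)
  have root_fs: "poly (?p k) z = 0 \<longleftrightarrow> z \<in> set (fs k)" for k z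
    unfolding fs by (auto simp: poly_prod_list prod_list_zero_iff)
  have nz_spec: "nonzero_spectrum (u k * ?a) = set (fs k) - {0}" for k
    unfolding nonzero_spectrum_mult_rank_one_sum root_fs by auto
  \<comment> \<open>Having n distinct nonzero values in a list of length n leaves no room for a
    repetition or for a zero.\<close>
  have "card (set (fs k) - {0}) = n" for k
    using u(1)[of k] by (simp add: rank_attaining_rank_one_sum[OF red] nz_spec)
  then have fs_distinct: "0 \<notin> set (fs k)" "distinct (fs k)" for k
  proof -
    assume card: "\<And>k. card (set (fs k) - {0}) = n"
    have "card (set (fs k)) \<le> n" using card_length[of "fs k"] fs(2) by simp
    moreover have "card (set (fs k) - {0}) < card (set (fs k))" if "0 \<in> set (fs k)"
      using that by (intro psubset_card_mono) auto
    ultimately show "0 \<notin> set (fs k)" using card[of k] by auto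
    then show "distinct (fs k)" using card[of k] fs(2)[of k] by (intro card_distinct) simp
  qed
  have "\<exists>k. card {i. i < n \<and> fs k ! i \<in> ball w r} = card {i. i < n \<and> es ! i = w}"
  proof (rule root_count_limit[OF _ _ r(1)])
    fix k i assume "i < n"
    then have "fs k ! i \<in> set (fs k)" using fs(2)[of k] by simp
    then have "fs k ! i \<in> nonzero_spectrum (u k * ?a)" using nz_spec fs_distinct(1)[of k] by auto
    then have "cmod (fs k ! i) \<le> norm (u k * ?a)"
      by (intro spectrum_norm_le) (simp add: nonzero_spectrum_def)
    also have "\<dots> \<le> norm (u k) * norm ?a" by (rule norm_mult_ineq)
    also have "norm (u k) \<le> norm (1 :: 'a) + 1"
      using norm_triangle_ineq4[of 1 "1 - u k"] u_near[of k] by simp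
    finally show "cmod (fs k ! i) \<le> (norm (1 :: 'a) + 1) * norm ?a" by (simp add: mult_right_mono)
  next
    fix z
    have "(\<lambda>k. poly (?p k) z) \<longlonglongrightarrow> poly (charpoly n (gram (\<lambda>i. 1 * x i) y)) z"
      by (rule tendsto_charpoly_gram[OF u_lim])
    then show "(\<lambda>k. \<Prod>i<n. z - fs k ! i) \<longlonglongrightarrow> (\<Prod>i<n. z - es ! i)"
      unfolding fs(1) prod_nth[OF fs(2)] mult_1_left es(2) prod_nth[OF es(1)] .
  next
    fix i assume i: "i < n" "es ! i \<in> cball w r"
    have "poly (charpoly n (gram x y)) (es ! i) = 0"
      unfolding es(2) prod_nth[OF es(1)] using i(1) by (auto simp: prod_zero_iff)
    then have "es ! i \<in> spectrum ?a" by (rule gram_root_in_spectrum[OF red])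
    then show "es ! i = w" using r i(2) by auto
  qed
  then obtain k where k: "card {i. i < n \<and> fs k ! i \<in> ball w r} = ?m" by blast
  have "spectrum (u k * ?a) \<inter> ball w r = set (fs k) \<inter> ball w r"
  proof -
    \<comment> \<open>If the disc contains 0, then isolation of the nonzero \<open>w\<close> makes
      \<open>?a\<close> invertible; \<open>u k\<close> is invertible too, being close to 1, so 0
      adds no point to the count.\<close>
    have "0 \<notin> spectrum (u k * ?a)" if "0 \<in> ball w r"
    proof -
      have "0 \<in> closure (ball w r)" using that closure_subset by blast
      then have "0 \<notin> spectrum ?a" using r(2) w by auto
      then obtain b where b: "?a * b = 1" "b * ?a = 1" unfolding zero_in_spectrum_iff by blast
      obtain v where v: "u k * v = 1" "v * u k = 1"
        using neumann_inverse[OF u_near[of k]] by (auto simp: algebra_simps)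
      have "u k * ?a * (b * v) = u k * (?a * b) * v" by (simp add: mult.assoc)
      moreover have "b * v * (u k * ?a) = b * (v * u k) * ?a" by (simp add: mult.assoc)
      ultimately show ?thesis unfolding zero_in_spectrum_iff using b v by auto
    qed
    moreover have "spectrum (u k * ?a) - {0} = set (fs k)"
      using nz_spec[of k] fs_distinct(1)[of k] by (auto simp: nonzero_spectrum_def)
    ultimately show ?thesis by blast
  qed
  moreover have "card (set (fs k) \<inter> ball w r) = card {i. i < n \<and> fs k ! i \<in> ball w r}"
  proof -
    have "set (fs k) \<inter> ball w r = (\<lambda>i. fs k ! i) ` {i. i < n \<and> fs k ! i \<in> ball w r}"
      using fs(2)[of k] by (auto simp: in_set_conv_nth)
    moreover have "inj_on (\<lambda>i. fs k ! i) {i. i < n \<and> fs k ! i \<in> ball w r}"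
      using fs_distinct(2)[of k] fs(2)[of k] by (auto simp: inj_on_def nth_eq_iff_index_eq)
    ultimately show ?thesis by (simp add: card_image)
  qed
  ultimately have "ecard (spectrum (u k * ?a) \<inter> ball w r) = enat ?m"
    using k by (simp add: ecard_def)
  then show False using u(3)[of k] by contradiction
qed

text \<open>Uniqueness holds since some radius is admissible and rank-attaining elements exist
  arbitrarily close to 1, so two candidate numbers can be compared at a common
  \<open>u\<close>.\<close>

lemma spectral_multiplicity_eq_count:
  assumes red: "reduced n x y" and es: "length es = n" "charpoly n (gram x y) = (\<Prod>e\<leftarrow>es. [:- e, 1:])"
    and w: "w \<noteq> 0"
  shows "spectral_multiplicity w (rank_one_sum n x y) = card {i. i < n \<and> es ! i = w}"
  unfolding spectral_multiplicity_def
proof (rule the_equality)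
  let ?a = "rank_one_sum n x y"
  show count: "\<forall>r>0. closure (ball w r) \<inter> spectrum ?a \<subseteq> {w} \<longrightarrow>
    (\<exists>\<epsilon>>0. \<forall>u \<in> rank_attaining ?a \<inter> ball 1 \<epsilon>.
      ecard (spectrum (u * ?a) \<inter> ball w r) = enat (card {i. i < n \<and> es ! i = w}))"
    using spectral_count_near_one[OF assms] by blast
  fix m assume m: "\<forall>r>0. closure (ball w r) \<inter> spectrum ?a \<subseteq> {w} \<longrightarrow>
    (\<exists>\<epsilon>>0. \<forall>u \<in> rank_attaining ?a \<inter> ball 1 \<epsilon>. ecard (spectrum (u * ?a) \<inter> ball w r) = enat m)"
  have "finite (spectrum ?a)"
    using nonzero_spectrum_mult_finite[of 1 n x y] finite_nonzero_spectrum_iff[of ?a] by simp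
  then obtain d where d: "d > 0" "\<And>z. z \<in> spectrum ?a \<Longrightarrow> z \<noteq> w \<Longrightarrow> d \<le> dist w z"
    using finite_set_avoid by metis
  define r where "r = d / 2"
  have r: "r > 0" "closure (ball w r) \<inter> spectrum ?a \<subseteq> {w}"
    using d by (auto simp: r_def) (smt (verit, best) d(1) d(2) field_sum_of_halves)
  obtain \<epsilon>1 where 1: "\<epsilon>1 > 0" "\<And>u. u \<in> rank_attaining ?a \<inter> ball 1 \<epsilon>1 \<Longrightarrow> ecard (spectrum (u * ?a) \<inter> ball w r) = enat m"
    using m r by blast
  obtain \<epsilon>2 where 2: "\<epsilon>2 > 0" "\<And>u. u \<in> rank_attaining ?a \<inter> ball 1 \<epsilon>2 \<Longrightarrow>
      ecard (spectrum (u * ?a) \<inter> ball w r) = enat (card {i. i < n \<and> es ! i = w})"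
    using count r by blast
  obtain u where "u \<in> ball 1 (min \<epsilon>1 \<epsilon>2)" "card (nonzero_spectrum (u * ?a)) = n"
    using card_nonzero_spectrum_dense[OF red, of "min \<epsilon>1 \<epsilon>2"] 1(1) 2(1) by auto
  then show "m = card {i. i < n \<and> es ! i = w}"
    using 1(2)[of u] 2(2)[of u] by (simp add: rank_attaining_rank_one_sum[OF red])
qed

text \<open>Grouping the n roots of the characteristic polynomial by value turns the weighted sum of
  multiplicities into the matrix trace. Each root lies in the spectrum, whence the bound.\<close>

theorem
  assumes red: "reduced n x y"
  shows Tr_rank_one_sum: "Tr (rank_one_sum n x y) = (\<Sum>i<n. \<phi> (y i * x i))"
    and cmod_Tr_rank_one_sum_le: "cmod (Tr (rank_one_sum n x y)) \<le> n * spectral_radius (rank_one_sum n x y)"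
proof -
  let ?a = "rank_one_sum n x y"
  obtain es where es: "length es = n" "charpoly n (gram x y) = (\<Prod>e\<leftarrow>es. [:- e, 1:])"
    and tr: "(\<Sum>i<n. gram x y i i) = sum_list es"
    by (rule charpoly_schur_perturbation[of n "gram x y"]) blast
  have fin: "finite (spectrum ?a)"
    using nonzero_spectrum_mult_finite[of 1 n x y] finite_nonzero_spectrum_iff[of ?a] by simp
  have es_spec: "es ! i \<in> spectrum ?a" if "i < n" for i
    by (rule gram_root_in_spectrum[OF red])
      (use that es in \<open>auto simp: poly_prod_list prod_list_zero_iff\<close>)
  have "Tr ?a = (\<Sum>z\<in>spectrum ?a. \<Sum>i\<in>{i \<in> {..<n}. es ! i = z}. es ! i)"
    unfolding Tr_def
  proof (rule sum.cong[OF refl])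
    fix z
    have "(\<Sum>i\<in>{i \<in> {..<n}. es ! i = z}. es ! i) = (\<Sum>i\<in>{i \<in> {..<n}. es ! i = z}. z)"
      by (intro sum.cong) auto
    also have "\<dots> = z * of_nat (card {i. i < n \<and> es ! i = z})" by (simp add: mult.commute)
    \<comment> \<open>The multiplicity at 0 carries weight 0, so its value is never
      computed.\<close>
    also have "\<dots> = z * of_nat (spectral_multiplicity z ?a)"
      by (cases "z = 0") (simp_all add: spectral_multiplicity_eq_count[OF red es])
    finally show "z * of_nat (spectral_multiplicity z ?a) = (\<Sum>i\<in>{i \<in> {..<n}. es ! i = z}. es ! i)" ..
  qed
  also have "\<dots> = (\<Sum>i<n. es ! i)"
    by (rule sum.group[OF _ fin]) (use es_spec in auto)
  finally have Tr_es: "Tr ?a = (\<Sum>i<n. es ! i)" .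
  also have "\<dots> = sum_list es" using es(1) by (simp add: sum_list_sum_nth atLeast0LessThan)
  finally show "Tr ?a = (\<Sum>i<n. \<phi> (y i * x i))" using tr by (simp add: gram_def)
  have "cmod (es ! i) \<le> spectral_radius ?a" if "i < n" for i
    unfolding spectral_radius_def
    by (intro cSUP_upper es_spec that bounded_imp_bdd_above finite_imp_bounded finite_imageI fin)
  then have "(\<Sum>i<n. cmod (es ! i)) \<le> (\<Sum>i<n. spectral_radius ?a)" by (intro sum_mono) auto
  then show "cmod (Tr ?a) \<le> n * spectral_radius ?a"
    unfolding Tr_es using norm_sum[of "\<lambda>i. es ! i" "{..<n}"] by simp
qed

text \<open>
  The element \<open>x * e * y\<close> has square \<open>\<phi> (y * x)\<close> times itself, so \<open>f (x * e * y)\<close> vanishes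
  whenever \<open>\<phi> (y * x)\<close> does; two bilinear forms related in this way are proportional.
\<close>

lemma functional_rank_one:
  assumes lin: "linear_functional_on Soc f" and sq: "\<And>a. a \<in> Soc \<Longrightarrow> a\<^sup>2 = 0 \<Longrightarrow> f a = 0"
  shows "f (x * e * y) = f e * \<phi> (y * x)"
proof -
  have S: "x * e * y \<in> Soc" for x y by (intro socleD(3,4) e_socle)
  have add: "f (a + b) = f a + f b" if "a \<in> Soc" "b \<in> Soc" for a b
    using lin that by (auto simp: linear_functional_on_def)
  have scale: "f (c *\<^sub>C a) = c * f a" if "a \<in> Soc" for a c
    using lin that by (auto simp: linear_functional_on_def)
  have add_scale: "f (x * e * y + c *\<^sub>C (x' * e * y')) = f (x * e * y) + c * f (x' * e * y')" for x y x' y' c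
    using add[OF S socle_scaleC[OF S]] scale[OF S] by simp
  have zero: "f (x * e * y) = 0" if "\<phi> (y * x) = 0" for x y
  proof (rule sq[OF S])
    have "(x * e * y)\<^sup>2 = x * (e * (y * x * (e * y)))" by (simp add: power2_eq_square mult.assoc)
    also have "\<dots> = 0" unfolding sandwich' that by simp
    finally show "(x * e * y)\<^sup>2 = 0" .
  qed
  \<comment> \<open>The scalar \<open>?t\<close> is chosen to make \<phi>(y (x - t)) zero; what
    remains of x e y is t e y.\<close>
  have left: "f (x * e * y) = f (e * y) * \<phi> (y * x) / \<phi> y" if "\<phi> y \<noteq> 0" for x y
  proof -
    let ?t = "\<phi> (y * x) / \<phi> y"
    have "f ((x - ?t *\<^sub>C 1) * e * y) = 0"
      using that by (intro zero) (simp add: right_diff_distrib linear_functional_onD(4)[OF linear_\<phi>] \<phi>_scaleC)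
    moreover have "x * e * y = (x - ?t *\<^sub>C 1) * e * y + ?t *\<^sub>C (1 * e * y)"
      by (simp add: left_diff_distrib)
    then have "f (x * e * y) = f ((x - ?t *\<^sub>C 1) * e * y) + ?t * f (1 * e * y)"
      by (simp only: add_scale[symmetric])
    ultimately show ?thesis by simp
  qed
  have e_y: "f (e * y) = f e * \<phi> y" for y
  proof -
    have "f (1 * e * (y - \<phi> y *\<^sub>C 1)) = 0"
      by (intro zero) (simp add: linear_functional_onD(4)[OF linear_\<phi>] \<phi>_scaleC \<phi>_one)
    moreover have "e * y = 1 * e * (y - \<phi> y *\<^sub>C 1) + \<phi> y *\<^sub>C (1 * e * 1)"
      by (simp add: right_diff_distrib)
    then have "f (e * y) = f (1 * e * (y - \<phi> y *\<^sub>C 1)) + \<phi> y * f (1 * e * 1)"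
      by (simp only: add_scale[symmetric])
    ultimately show ?thesis by simp
  qed
  show ?thesis
  proof (cases "\<phi> y = 0")
    case False
    then show ?thesis using left[of y x] e_y[of y] by simp
  next
    case True
    \<comment> \<open>Shifting \<open>y\<close> by 1 leads back to the case of nonzero \<phi>, and
      additivity removes the shift.\<close>
    then have y1: "\<phi> (y + 1) = 1" by (simp add: \<phi>_add \<phi>_one)
    have "f (x * e * (y + 1)) = f e * \<phi> ((y + 1) * x)"
      using left[of "y + 1" x] e_y[of "y + 1"] y1 by simp
    moreover have "f (x * e * 1) = f e * \<phi> (1 * x)"
      using left[of 1 x] e_y[of 1] \<phi>_one by simp
    moreover have "f (x * e * (y + 1)) = f (x * e * y) + f (x * e * 1)"
      using add[OF S S, of x y x 1] by (simp add: distrib_left)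
    ultimately show ?thesis by (simp add: distrib_right \<phi>_add algebra_simps)
  qed
qed

lemma functional_rank_one_sum:
  assumes lin: "linear_functional_on Soc f" and sq: "\<And>a. a \<in> Soc \<Longrightarrow> a\<^sup>2 = 0 \<Longrightarrow> f a = 0"
  shows "f (rank_one_sum n x y) = f e * (\<Sum>i<n. \<phi> (y i * x i))"
proof -
  \<comment> \<open>Membership is carried along because additivity of \<open>f\<close> is assumed on
    the socle only.\<close>
  have "rank_one_sum n x y \<in> Soc \<and> f (rank_one_sum n x y) = f e * (\<Sum>i<n. \<phi> (y i * x i))"
  proof (induction n)
    case 0
    have "f (0 *\<^sub>C e) = 0 * f e" using lin e_socle unfolding linear_functional_on_def by blast
    then show ?case by (simp add: rank_one_sum_def socleD(1))
  next
    case (Suc n)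
    have S: "x n * e * y n \<in> Soc" by (intro socleD(3,4) e_socle)
    have "rank_one_sum (Suc n) x y = rank_one_sum n x y + x n * e * y n" by (simp add: rank_one_sum_def)
    moreover have "f (rank_one_sum n x y + x n * e * y n) = f (rank_one_sum n x y) + f (x n * e * y n)"
      using lin Suc S by (auto simp: linear_functional_on_def)
    ultimately show ?case
      using Suc S socleD(2) functional_rank_one[OF assms, of "x n" "y n"] by (simp add: distrib_left)
  qed
  then show ?thesis by simp
qed

end

section \<open>Nilpotent elements and the equivalences\<close>

lemma nilpotent_spectrum_subset:
  fixes a :: "'a::complex_banach_algebra_1"
  assumes "nilpotent a"
  shows "spectrum a \<subseteq> {0}"
proof
  fix z assume z: "z \<in> spectrum a"
  obtain n where n: "a ^ n = 0" using assms by (auto simp: nilpotent_def)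
  show "z \<in> {0}"
  proof (rule ccontr)
    assume "z \<notin> {0}"
    then have z0: "z \<noteq> 0" by simp
    define u where "u = inverse z *\<^sub>C a"
    have un: "u ^ n = 0" by (simp add: u_def scaleC_power n)
    have a: "z *\<^sub>C 1 - a = z *\<^sub>C (1 - u)" using z0 by (simp add: u_def scaleC.scale_right_diff_distrib)
    have 1: "(1 - u) * (\<Sum>j<n. u ^ j) = 1" using geometric_identity[of u n] un by simp
    moreover have "(\<Sum>j<n. u ^ j) * u = u * (\<Sum>j<n. u ^ j)"
      by (simp add: sum_distrib_left sum_distrib_right power_commutes)
    then have "(\<Sum>j<n. u ^ j) * (1 - u) = (1 - u) * (\<Sum>j<n. u ^ j)"
      by (simp add: left_diff_distrib right_diff_distrib)
    ultimately have "z \<notin> spectrum a"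
      using z0 by (intro not_in_spectrumI[of _ _ "inverse z *\<^sub>C (\<Sum>j<n. u ^ j)"]) (simp_all add: a)
    then show False using z by contradiction
  qed
qed

lemma Tr_nilpotent:
  assumes "nilpotent a"
  shows "Tr a = 0"
  unfolding Tr_def using nilpotent_spectrum_subset[OF assms] by (intro sum.neutral) auto

text \<open>An inverse b of \<open>a\<close> would give 1 = a^2 b^2 = 0, so 0 is in the spectrum.
  This has to be shown because \<open>spectral_radius\<close> is a supremum over the spectrum, whose
  value would be unspecified on the empty set.\<close>

lemma spectral_radius_square_zero:
  fixes a :: "'a::complex_banach_algebra_1"
  assumes "a\<^sup>2 = 0"
  shows "spectral_radius a = 0"
proof -
  have nil: "nilpotent a" using assms by (auto simp: nilpotent_def)
  have "0 \<in> spectrum a"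
  proof (rule ccontr)
    assume "0 \<notin> spectrum a"
    then obtain b where b: "a * b = 1" unfolding zero_in_spectrum_iff by blast
    have "a * (a * b) * b = a\<^sup>2 * (b * b)" by (simp add: power2_eq_square mult.assoc)
    then show False using b assms by simp
  qed
  then have "spectrum a = {0}" using nilpotent_spectrum_subset[OF nil] by auto
  then show ?thesis by (simp add: spectral_radius_def)
qed

text \<open>Ranks of socle elements are finite, so \<open>the_enat\<close> loses nothing in the last
  condition.\<close>

theorem theorem3p11:
  fixes f :: "'a::complex_banach_algebra_1 \<Rightarrow> complex"
  assumes "semisimple TYPE('a)"
    and "minimal_two_sided_ideal (Soc :: 'a set)"
    and "linear_functional_on Soc f"
  shows "((\<exists>\<alpha>. \<forall>a\<in>Soc. f a = \<alpha> * Tr a) \<longleftrightarrow>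
            (\<forall>a\<in>Soc. nilpotent a \<longrightarrow> f a = 0)) \<and>
         ((\<forall>a\<in>Soc. nilpotent a \<longrightarrow> f a = 0) \<longleftrightarrow>
            (\<forall>a\<in>Soc. a\<^sup>2 = 0 \<longrightarrow> f a = 0)) \<and>
         ((\<forall>a\<in>Soc. a\<^sup>2 = 0 \<longrightarrow> f a = 0) \<longleftrightarrow>
            (\<exists>c::real. c > 0 \<and>
              (\<forall>a\<in>Soc. cmod (f a) \<le> c * real (the_enat (elem_rank a)) * spectral_radius a)))"
    (is "(?a \<longleftrightarrow> ?b) \<and> (?b \<longleftrightarrow> ?c) \<and> (?c \<longleftrightarrow> ?d)")
proof -
  have S: "two_sided_ideal (Soc :: 'a set)" using assms(2) by (simp add: minimal_two_sided_ideal_def)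
  have ab: "?b" if "?a" using that Tr_nilpotent by (metis mult_zero_right)
  have bc: "?c" if "?b" using that by (auto simp: nilpotent_def)
  have dc: "?c" if d: "?d"
  proof (intro ballI impI)
    fix a :: 'a assume a: "a \<in> Soc" "a\<^sup>2 = 0"
    obtain c where "cmod (f a) \<le> c * real (the_enat (elem_rank a)) * spectral_radius a"
      using d a(1) by blast
    then show "f a = 0" by (simp add: spectral_radius_square_zero[OF a(2)])
  qed
  have cad: "?a \<and> ?d" if sq: "?c"
  proof (cases "(Soc :: 'a set) = {0}")
    \<comment> \<open>A zero socle contains no nonzero idempotent; there \<open>f 0 = 0\<close>, and
      the scalar 0 and the constant 1 serve.\<close>
    case True
    have "f 0 = 0"
    proof -
      have "f (0 *\<^sub>C 0) = 0 * f 0" using assms(3) True unfolding linear_functional_on_def by blast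
      then show ?thesis by simp
    qed
    moreover have "spectral_radius (0 :: 'a) = 0" by (rule spectral_radius_square_zero) simp
    ultimately show ?thesis unfolding True by (auto intro!: exI[of _ 0] exI[of _ 1])
  next
    case False
    obtain e :: 'a and \<phi> where "e \<in> Soc" "e \<noteq> 0" "e * e = e" "\<And>z. e * z * e = \<phi> z *\<^sub>C e"
      using minimal_idempotent_exists[OF assms(1,2) False] by blast
    then interpret minimal_idempotent e \<phi> by unfold_locales (use assms(2) in auto)
    have rep: "f a = f e * Tr a \<and> cmod (Tr a) \<le> real (the_enat (elem_rank a)) * spectral_radius a"
      if "a \<in> Soc" for a
    proof -
      obtain n x y where a: "a = rank_one_sum n x y" "reduced n x y"
        by (rule reduced_representation[OF \<open>a \<in> Soc\<close>])
      have "f a = f e * Tr a"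
        unfolding a(1) Tr_rank_one_sum[OF a(2)]
        by (rule functional_rank_one_sum[OF assms(3)]) (use sq in blast)
      moreover have "cmod (Tr a) \<le> real (the_enat (elem_rank a)) * spectral_radius a"
        unfolding a(1) elem_rank_rank_one_sum[OF a(2)]
        using cmod_Tr_rank_one_sum_le[OF a(2)] by simp
      ultimately show ?thesis by blast
    qed
    \<comment> \<open>The summand 1 keeps the constant positive when \<open>f e\<close> is
      0.\<close>
    have "cmod (f a) \<le> (cmod (f e) + 1) * real (the_enat (elem_rank a)) * spectral_radius a" if "a \<in> Soc" for a
    proof -
      have "cmod (f a) = cmod (f e) * cmod (Tr a)" using rep[OF that] by (simp add: norm_mult)
      also have "\<dots> \<le> (cmod (f e) + 1) * (real (the_enat (elem_rank a)) * spectral_radius a)"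
        using rep[OF that] by (intro mult_mono) auto
      finally show ?thesis by (simp add: mult.assoc)
    qed
    moreover have "cmod (f e) + 1 > 0" by (simp add: add_nonneg_pos)
    ultimately have ?d by blast
    moreover have ?a using rep by blast
    ultimately show ?thesis by blast
  qed
  show ?thesis using ab bc dc cad by blast
qed

end
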